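(* Let $\mathcal{Q}$ be an $((n,M,d;0))$ CWS code with CWS group $S\subset\mathcal{P}^n$ and set of word operators $W\subset\mathcal{P}^n$, $|W|=M$, and let $\{A_j\}_{j=0}^n$ be its $A$-type Shor--Laflamme weight enumerator. Then for every $j\in\{0,1,\dots,n\}$, $$A_j=\frac{1}{M^2}\sum_{\beta\in\mathcal{E}_j^n\cap\varphi(S)}\bigl|W_{\mathrm c}(\beta)-W_{\mathrm a}(\beta)\bigr|^2 .$$ Moreover, for $0\le j<d$, $$A_j=\bigl|\{\beta\in\mathcal{E}_j^n\cap\varphi(S): W_{\mathrm c}(\beta)=M\}\bigr| .$$
   Context: Let $I,\sigma_x,\sigma_y,\sigma_z$ be the $2\times2$ identity and the Pauli matrices, $\mathcal{E}^n=\{\sigma_1\otimes\cdots\otimes\sigma_n:\sigma_i\in\{I,\sigma_x,\sigma_y,\sigma_z\}\}$, and $\mathcal{P}^n=\{\mathbf{i}^k\alpha: k\in\{0,1,2,3\},\alpha\in\mathcal{E}^n\}$ with $\mathbf{i}=\sqrt{-1}$. Define $\varphi:\mathcal{P}^n\to\mathcal{E}^n$ by $\varphi(\mathbf{i}^k\alpha)=\alpha$ (it forgets the phase). The weight $\mathrm{wt}$ of a Pauli operator is its number of non-identity tensor factors, and $\mathcal{E}_j^n=\{\beta\in\mathcal{E}^n:\mathrm{wt}(\beta)=j\}$. A stabilizer group is an abelian subgroup of $\mathcal{P}^n$ not containing $-I^{\otimes n}$. A CWS group is a maximal stabilizer group $S\subset\mathcal{P}^n$; it has a unique (up to phase) unit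 vector $|S\rangle\in\mathbb{C}^{2^n}$ with $s|S\rangle=|S\rangle$ for all $s\in S$. An error $\alpha\in\mathcal{E}^n$ is detectable by a subspace $\mathcal{Q}\subset\mathbb{C}^{2^n}$ if, for an orthonormal basis $\{|v_i\rangle\}$ of $\mathcal{Q}$, $\langle v_i|\alpha|v_i\rangle=\langle v_j|\alpha|v_j\rangle$ for all $i,j$ and $\langle v_i|\alpha|v_j\rangle=0$ for all $i\neq j$. $\mathcal{Q}$ has minimum distance $d$ if all $\alpha\in\mathcal{E}^n$ of weight at most $d-1$ are detectable, but not all those of weight $d$. An $((n,M,d;0))$ CWS code with CWS group $S$ and word operators $W$ is an $M$-dimensional subspace $\mathcal{Q}\subset\mathbb{C}^{2^n}$ of minimum distance $d$, where $W=\{\omega_1=I^{\otimes n},\omega_2,\dots,\omega_M\}\subset\mathcal{P}^n$ is a set of $M$ pairwise commuting operators such that $\{\omega_1|S\rangle,\dots,\omega_M|S\rangle\}$ is an orthonormal basis of $\mathcal{Q}$. With $P$ the orthogonal projector onto $\mathcal{Q}$, $A_j=\frac{1}{(\mathrm{Tr}P)^2}\sum_{\beta\in\mathcal{E}_j^n}\mathrm{Tr}(\beta P)\,\mathrm{Tr}(\beta P)$ for $j=0,\dots,n$. For $\beta\in\mathcal{P}^n$: $W_{\mathrm c}(\beta)=|\{\omega\in W:\omega\beta=\beta\omega\}|$ and $W_{\mathrm a}(\beta)=|\{\omega\in W:\omega\beta=-\beta\omega\}|$. *)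

theory Defs
  imports "HOL-Algebra.Group" "Jordan_Normal_Form.Schur_Decomposition"
begin

section \<open>Pauli operators on \<open>n\<close> qubits\<close>

text \<open>Operators on \<open>\<complex>\<^bsup>2^n\<^esup>\<close> are matrices in \<^term>\<open>carrier_mat (2^n) (2^n)\<close>, states are vectors in
  \<^term>\<open>carrier_vec (2^n)\<close>.\<close>

definition pauli_x :: "complex mat" where
  "pauli_x = mat_of_rows_list 2 [[0, 1], [1, 0]]"

definition pauli_y :: "complex mat" where
  "pauli_y = mat_of_rows_list 2 [[0, - \<i>], [\<i>, 0]]"

definition pauli_z :: "complex mat" where
  "pauli_z = mat_of_rows_list 2 [[1, 0], [0, - 1]]"

definition paulis :: "complex mat set" where
  "paulis = {1\<^sub>m 2, pauli_x, pauli_y, pauli_z}"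

definition kronecker :: "complex mat \<Rightarrow> complex mat \<Rightarrow> complex mat" where
  "kronecker A B = mat (dim_row A * dim_row B) (dim_col A * dim_col B)
     (\<lambda>(i, j). A $$ (i div dim_row B, j div dim_col B) * B $$ (i mod dim_row B, j mod dim_col B))"

definition tensor :: "complex mat list \<Rightarrow> complex mat" where
  "tensor \<sigma>s = foldr kronecker \<sigma>s (1\<^sub>m 1)"

definition pauli_strings :: "nat \<Rightarrow> complex mat list set" where
  "pauli_strings n = {\<sigma>s. length \<sigma>s = n \<and> set \<sigma>s \<subseteq> paulis}"

definition error_ops :: "nat \<Rightarrow> complex mat set" where
  "error_ops n = tensor ` pauli_strings n"

definition pauli_ops :: "nat \<Rightarrow> complex mat set" where
  "pauli_ops n = {\<i> ^ k \<cdot>\<^sub>m \<alpha> | k \<alpha>. k \<in> {0, 1, 2, 3::nat} \<and> \<alpha> \<in> error_ops n}"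

definition pauli_group :: "nat \<Rightarrow> complex mat monoid" where
  "pauli_group n = \<lparr>carrier = pauli_ops n, monoid.mult = (*), one = 1\<^sub>m (2^n)\<rparr>"

text \<open>The phase-forgetting map \<open>\<phi>\<close> is well defined on \<^term>\<open>pauli_ops n\<close>, since distinct elements of
  \<^term>\<open>error_ops n\<close> are linearly independent. For the same reason the Pauli string of an operator
  is unique, and so is its weight.\<close>

definition forget_phase :: "nat \<Rightarrow> complex mat \<Rightarrow> complex mat" where
  "forget_phase n \<beta> =
     (THE \<alpha>. \<alpha> \<in> error_ops n \<and> (\<exists>k\<in>{0, 1, 2, 3::nat}. \<beta> = \<i> ^ k \<cdot>\<^sub>m \<alpha>))"

definition pauli_weight :: "nat \<Rightarrow> complex mat \<Rightarrow> nat" where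
  "pauli_weight n \<beta> =
     (THE w. \<exists>\<sigma>s\<in>pauli_strings n. tensor \<sigma>s = forget_phase n \<beta> \<and>
        w = card {i. i < n \<and> \<sigma>s ! i \<noteq> 1\<^sub>m 2})"

definition error_ops_weight :: "nat \<Rightarrow> nat \<Rightarrow> complex mat set" where
  "error_ops_weight n j = {\<beta> \<in> error_ops n. pauli_weight n \<beta> = j}"


section \<open>Hilbert space notions\<close>

text \<open>The scalar product \<open>u \<bullet>c v\<close> of the library is conjugate-linear in its second argument, so
  \<open>\<langle>u|A|v\<rangle>\<close> is \<open>(A *\<^sub>v v) \<bullet>c u\<close>.\<close>

definition sandwich :: "complex vec \<Rightarrow> complex mat \<Rightarrow> complex vec \<Rightarrow> complex" where
  "sandwich u A v = (A *\<^sub>v v) \<bullet>c u"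

abbreviation qubit_space :: "nat \<Rightarrow> (complex, complex vec) module" where
  "qubit_space n \<equiv> module_vec TYPE(complex) (2^n)"

definition orthonormal_basis ::
    "nat \<Rightarrow> 'i set \<Rightarrow> ('i \<Rightarrow> complex vec) \<Rightarrow> complex vec set \<Rightarrow> bool" where
  "orthonormal_basis n I v Q \<longleftrightarrow>
     v ` I \<subseteq> carrier_vec (2^n) \<and>
     (\<forall>i\<in>I. \<forall>j\<in>I. v j \<bullet>c v i = (if i = j then 1 else 0)) \<and>
     LinearCombinations.module.span class_ring (qubit_space n) (v ` I) = Q"

definition is_orthogonal_projector :: "nat \<Rightarrow> complex vec set \<Rightarrow> complex mat \<Rightarrow> bool" where
  "is_orthogonal_projector n Q P \<longleftrightarrow>
     P \<in> carrier_mat (2^n) (2^n) \<and> P * P = P \<and> mat_adjoint P = P \<and>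
     {P *\<^sub>v x | x. x \<in> carrier_vec (2^n)} = Q"

definition orthogonal_projector :: "nat \<Rightarrow> complex vec set \<Rightarrow> complex mat" where
  "orthogonal_projector n Q = (THE P. is_orthogonal_projector n Q P)"

definition mat_trace :: "complex mat \<Rightarrow> complex" where
  "mat_trace A = (\<Sum>i<dim_row A. A $$ (i, i))"


section \<open>CWS codes and their weight enumerators\<close>

definition stabilizer_group :: "nat \<Rightarrow> complex mat set \<Rightarrow> bool" where
  "stabilizer_group n S \<longleftrightarrow>
     subgroup S (pauli_group n) \<and> (\<forall>s\<in>S. \<forall>t\<in>S. s * t = t * s) \<and> - 1\<^sub>m (2^n) \<notin> S"

definition cws_group :: "nat \<Rightarrow> complex mat set \<Rightarrow> bool" where
  "cws_group n S \<longleftrightarrow>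
     stabilizer_group n S \<and> (\<forall>T. stabilizer_group n T \<and> S \<subseteq> T \<longrightarrow> T = S)"

definition stabilizer_state :: "nat \<Rightarrow> complex mat set \<Rightarrow> complex vec \<Rightarrow> bool" where
  "stabilizer_state n S \<psi> \<longleftrightarrow>
     \<psi> \<in> carrier_vec (2^n) \<and> \<psi> \<bullet>c \<psi> = 1 \<and> (\<forall>s\<in>S. s *\<^sub>v \<psi> = \<psi>)"

definition detectable :: "nat \<Rightarrow> complex vec set \<Rightarrow> complex mat \<Rightarrow> bool" where
  "detectable n Q \<alpha> \<longleftrightarrow>
     (\<exists>(m::nat) v. orthonormal_basis n {..<m} v Q \<and>
        (\<forall>i<m. \<forall>j<m. sandwich (v i) \<alpha> (v i) = sandwich (v j) \<alpha> (v j)) \<and>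
        (\<forall>i<m. \<forall>j<m. i \<noteq> j \<longrightarrow> sandwich (v i) \<alpha> (v j) = 0))"

definition minimum_distance :: "nat \<Rightarrow> complex vec set \<Rightarrow> nat \<Rightarrow> bool" where
  "minimum_distance n Q d \<longleftrightarrow>
     (\<forall>\<alpha>\<in>error_ops n. pauli_weight n \<alpha> < d \<longrightarrow> detectable n Q \<alpha>) \<and>
     \<not> (\<forall>\<alpha>\<in>error_ops_weight n d. detectable n Q \<alpha>)"

text \<open>The state stabilized by \<open>S\<close> is unique only up to a phase, and the code does not depend on the
  choice of the phase.\<close>

definition cws_code ::
    "nat \<Rightarrow> nat \<Rightarrow> nat \<Rightarrow> complex mat set \<Rightarrow> complex mat set \<Rightarrow> complex vec set \<Rightarrow> bool" where
  "cws_code n M d S W Q \<longleftrightarrow>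
     cws_group n S \<and>
     W \<subseteq> pauli_ops n \<and> card W = M \<and> 1\<^sub>m (2^n) \<in> W \<and>
     (\<forall>\<omega>\<in>W. \<forall>\<omega>'\<in>W. \<omega> * \<omega>' = \<omega>' * \<omega>) \<and>
     VectorSpace.subspace class_ring Q (qubit_space n) \<and>
     vectorspace.dim class_ring ((qubit_space n)\<lparr>carrier := Q\<rparr>) = M \<and>
     minimum_distance n Q d \<and>
     (\<exists>\<psi>. stabilizer_state n S \<psi> \<and> orthonormal_basis n W (\<lambda>\<omega>. \<omega> *\<^sub>v \<psi>) Q)"

definition shor_laflamme_A :: "nat \<Rightarrow> complex vec set \<Rightarrow> nat \<Rightarrow> complex" where
  "shor_laflamme_A n Q j =
     (let P = orthogonal_projector n Q in
      1 / (mat_trace P)^2 *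
        (\<Sum>\<beta>\<in>error_ops_weight n j. mat_trace (\<beta> * P) * mat_trace (\<beta> * P)))"

definition commuting_words :: "complex mat set \<Rightarrow> complex mat \<Rightarrow> nat" where
  "commuting_words W \<beta> = card {\<omega> \<in> W. \<omega> * \<beta> = \<beta> * \<omega>}"

definition anticommuting_words :: "complex mat set \<Rightarrow> complex mat \<Rightarrow> nat" where
  "anticommuting_words W \<beta> = card {\<omega> \<in> W. \<omega> * \<beta> = - (\<beta> * \<omega>)}"

end

theory Submission
  imports Defs
begin

text \<open>Conjugating \<open>\<beta>\<close> by a word operator \<open>\<omega>\<close> multiplies it by \<open>\<plusminus>1\<close>, so
  \<open>Tr(\<beta>P) = (W\<^sub>c(\<beta>) - W\<^sub>a(\<beta>)) \<langle>S|\<beta>|S\<rangle>\<close>. If \<open>\<beta> \<in> \<phi>(S)\<close> then \<open>\<beta>\<close> or \<open>-\<beta>\<close> lies in \<open>S\<close>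
  and \<open>\<langle>S|\<beta>|S\<rangle> = \<plusminus>1\<close>. Otherwise, by maximality of \<open>S\<close>, \<open>\<beta>\<close> anticommutes with some element of \<open>S\<close>
  and \<open>\<langle>S|\<beta>|S\<rangle> = 0\<close>. If \<open>\<beta> \<in> \<phi>(S)\<close> is moreover detectable, all the diagonal entries
  \<open>\<langle>S|\<omega>\<^sup>\<dagger>\<beta>\<omega>|S\<rangle> = \<plusminus>\<langle>S|\<beta>|S\<rangle> \<noteq> 0\<close> agree with the one for \<open>\<omega> = I\<close>, so every word commutes
  with \<open>\<beta>\<close> and the summand is \<open>M\<^sup>2\<close>.\<close>

section \<open>Kronecker products and adjoints\<close>

lemma kronecker_carrier:
  "A \<in> carrier_mat a b \<Longrightarrow> B \<in> carrier_mat c d \<Longrightarrow> kronecker A B \<in> carrier_mat (a * c) (b * d)"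
  by (auto simp: kronecker_def)

lemma block_index_less:
  fixes i a k c :: nat
  assumes "i < a" "k < c"
  shows "i * c + k < a * c"
proof -
  have "i * c + k < Suc i * c" using assms(2) by simp
  also have "\<dots> \<le> a * c" using assms(1) by (intro mult_le_mono1) simp
  finally show ?thesis .
qed

lemma kronecker_index:
  assumes "A \<in> carrier_mat a b" "B \<in> carrier_mat c d" "i < a" "j < b" "k < c" "l < d"
  shows "kronecker A B $$ (i * c + k, j * d + l) = A $$ (i, j) * B $$ (k, l)"
proof -
  have "i * c + k < a * c" "j * d + l < b * d"
    using assms(3-6) by (simp_all add: block_index_less)
  then show ?thesis using assms by (auto simp: kronecker_def)
qed

text \<open>Writing \<open>k = i * b + j\<close> cuts the range into \<open>a\<close> blocks of
  length \<open>b\<close>. This splits the inner sum of a product of Kronecker products into a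
  double sum.\<close>

lemma sum_div_mod:
  fixes f :: "nat \<Rightarrow> nat \<Rightarrow> 'a::comm_monoid_add"
  shows "(\<Sum>k<a * b. f (k div b) (k mod b)) = (\<Sum>i<a. \<Sum>j<b. f i j)"
proof -
  have "(\<Sum>k<a * b. f (k div b) (k mod b)) = (\<Sum>i<a. \<Sum>k = i * b..<i * b + b. f (k div b) (k mod b))"
    by (rule sum.nat_group[symmetric])
  also have "\<dots> = (\<Sum>i<a. \<Sum>j<b. f i j)"
  proof (rule sum.cong[OF refl])
    fix i
    have "(\<Sum>k = i * b..<i * b + b. f (k div b) (k mod b)) =
          (\<Sum>k = 0..<b. f ((k + i * b) div b) ((k + i * b) mod b))"
      using sum.shift_bounds_nat_ivl[of "\<lambda>k. f (k div b) (k mod b)" 0 "i * b" b]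
      by (simp add: add.commute)
    also have "\<dots> = (\<Sum>j<b. f i j)"
      by (rule sum.cong) auto
    finally show "(\<Sum>k = i * b..<i * b + b. f (k div b) (k mod b)) = (\<Sum>j<b. f i j)" .
  qed
  finally show ?thesis .
qed

lemma mult_mat_index_sum:
  assumes "A \<in> carrier_mat a m" "B \<in> carrier_mat m b" "i < a" "j < b"
  shows "(A * B) $$ (i, j) = (\<Sum>k<m. A $$ (i, k) * B $$ (k, j))"
  using assms by (auto simp: scalar_prod_def atLeast0LessThan)

text \<open>The mixed-product rule: after separating quotients from remainders each summand factors,
  and a double sum of such products is a product of two sums.\<close>

lemma kronecker_mult:
  assumes A: "A \<in> carrier_mat a m" and C: "C \<in> carrier_mat m b"
    and B: "B \<in> carrier_mat c l" and D: "D \<in> carrier_mat l d"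
  shows "kronecker A B * kronecker C D = kronecker (A * C) (B * D)"
proof (rule eq_matI)
  show "dim_row (kronecker A B * kronecker C D) = dim_row (kronecker (A * C) (B * D))"
    and "dim_col (kronecker A B * kronecker C D) = dim_col (kronecker (A * C) (B * D))"
    using assms by (auto simp: kronecker_def)
  fix i j
  assume "i < dim_row (kronecker (A * C) (B * D))" "j < dim_col (kronecker (A * C) (B * D))"
  then have i: "i < a * c" and j: "j < b * d" using assms by (auto simp: kronecker_def)
  \<comment> \<open>The bound \<open>i < a * c\<close> forces \<open>c > 0\<close>, which is what
    makes \<open>i mod c < c\<close> true; likewise for \<open>d\<close>.\<close>
  have ij: "i div c < a" "i mod c < c" "j div d < b" "j mod d < d"
    using i j by (auto simp: less_mult_imp_div_less intro!: mod_less_divisor intro: Nat.gr0I)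
  have "(kronecker A B * kronecker C D) $$ (i, j) =
        (\<Sum>k<m * l. kronecker A B $$ (i, k) * kronecker C D $$ (k, j))"
    by (rule mult_mat_index_sum[OF kronecker_carrier[OF A B] kronecker_carrier[OF C D] i j])
  also have "\<dots> = (\<Sum>k<m * l. (A $$ (i div c, k div l) * C $$ (k div l, j div d)) *
                    (B $$ (i mod c, k mod l) * D $$ (k mod l, j mod d)))"
    using assms i j by (intro sum.cong) (auto simp: kronecker_def)
  also have "\<dots> = (\<Sum>p<m. \<Sum>q<l. (A $$ (i div c, p) * C $$ (p, j div d)) *
                    (B $$ (i mod c, q) * D $$ (q, j mod d)))"
    by (rule sum_div_mod)
  also have "\<dots> = (A * C) $$ (i div c, j div d) * (B * D) $$ (i mod c, j mod d)"
    unfolding mult_mat_index_sum[OF A C ij(1,3)] mult_mat_index_sum[OF B D ij(2,4)] sum_product ..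
  also have "\<dots> = kronecker (A * C) (B * D) $$ (i, j)"
    using assms i j by (auto simp: kronecker_def)
  finally show "(kronecker A B * kronecker C D) $$ (i, j) = kronecker (A * C) (B * D) $$ (i, j)" .
qed

lemma kronecker_smult: "kronecker (a \<cdot>\<^sub>m A) (b \<cdot>\<^sub>m B) = (a * b) \<cdot>\<^sub>m kronecker A B"
proof (rule eq_matI)
  fix i j
  assume "i < dim_row ((a * b) \<cdot>\<^sub>m kronecker A B)" "j < dim_col ((a * b) \<cdot>\<^sub>m kronecker A B)"
  then have i: "i < dim_row A * dim_row B" and j: "j < dim_col A * dim_col B"
    by (auto simp: kronecker_def)
  then have "i div dim_row B < dim_row A" "i mod dim_row B < dim_row B"
       "j div dim_col B < dim_col A" "j mod dim_col B < dim_col B"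
    by (auto simp: less_mult_imp_div_less intro!: mod_less_divisor intro: Nat.gr0I)
  then show "kronecker (a \<cdot>\<^sub>m A) (b \<cdot>\<^sub>m B) $$ (i, j) = ((a * b) \<cdot>\<^sub>m kronecker A B) $$ (i, j)"
    using i j by (simp add: kronecker_def)
qed (auto simp: kronecker_def)

lemma kronecker_one: "kronecker (1\<^sub>m a) (1\<^sub>m b) = 1\<^sub>m (a * b)"
proof (rule eq_matI)
  fix i j
  assume "i < dim_row (1\<^sub>m (a * b))" "j < dim_col (1\<^sub>m (a * b))"
  then have i: "i < a * b" and j: "j < a * b" by auto
  then have "i div b < a" "i mod b < b" "j div b < a" "j mod b < b"
    by (auto simp: less_mult_imp_div_less intro!: mod_less_divisor intro: Nat.gr0I)
  moreover have "i = j" if "i div b = j div b" "i mod b = j mod b"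
    using that by (metis div_mult_mod_eq)
  ultimately show "kronecker (1\<^sub>m a) (1\<^sub>m b) $$ (i, j) = 1\<^sub>m (a * b) $$ (i, j)"
    using i j by (auto simp: kronecker_def)
qed (auto simp: kronecker_def)

section \<open>Adjoints and the Hermitian scalar product\<close>

lemma mat_adjoint_dim [simp]:
  "dim_row (mat_adjoint A) = dim_col A" "dim_col (mat_adjoint A) = dim_row A"
  by (auto simp: mat_adjoint_def)

lemma mat_adjoint_index:
  fixes A :: "complex mat"
  shows "i < dim_col A \<Longrightarrow> j < dim_row A \<Longrightarrow> mat_adjoint A $$ (i, j) = cnj (A $$ (j, i))"
  by (auto simp: mat_adjoint_def mat_of_rows_def)

lemma mat_adjoint_kronecker: "mat_adjoint (kronecker A B) = kronecker (mat_adjoint A) (mat_adjoint B)"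
proof (rule eq_matI)
  fix i j
  assume "i < dim_row (kronecker (mat_adjoint A) (mat_adjoint B))"
         "j < dim_col (kronecker (mat_adjoint A) (mat_adjoint B))"
  then have i: "i < dim_col A * dim_col B" and j: "j < dim_row A * dim_row B"
    by (auto simp: kronecker_def)
  then have "i div dim_col B < dim_col A" "i mod dim_col B < dim_col B"
       "j div dim_row B < dim_row A" "j mod dim_row B < dim_row B"
    by (auto simp: less_mult_imp_div_less intro!: mod_less_divisor intro: Nat.gr0I)
  then show "mat_adjoint (kronecker A B) $$ (i, j) = kronecker (mat_adjoint A) (mat_adjoint B) $$ (i, j)"
    using i j by (simp add: kronecker_def mat_adjoint_index)
qed (auto simp: kronecker_def)

lemma cscalar_prod_sum:
  fixes y :: "complex vec"
  shows "y \<in> carrier_vec N \<Longrightarrow> x \<bullet>c y = (\<Sum>i<N. x $ i * cnj (y $ i))"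
  by (auto simp: scalar_prod_def atLeast0LessThan)

lemma mult_mat_vec_index_sum:
  assumes "A \<in> carrier_mat a m" "x \<in> carrier_vec m" "i < a"
  shows "(A *\<^sub>v x) $ i = (\<Sum>k<m. A $$ (i, k) * x $ k)"
  using assms by (auto simp: scalar_prod_def atLeast0LessThan)

text \<open>Both sides expand to the same double sum over entries, with the two summations
  interchanged.\<close>

lemma cscalar_prod_adjoint:
  fixes A :: "complex mat"
  assumes A: "A \<in> carrier_mat N N" and x: "x \<in> carrier_vec N" and y: "y \<in> carrier_vec N"
  shows "(A *\<^sub>v x) \<bullet>c y = x \<bullet>c (mat_adjoint A *\<^sub>v y)"
proof -
  have A': "mat_adjoint A \<in> carrier_mat N N" using A by (auto intro!: carrier_matI)
  have "(A *\<^sub>v x) \<bullet>c y = (\<Sum>i<N. \<Sum>k<N. A $$ (i, k) * x $ k * cnj (y $ i))"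
    by (simp add: cscalar_prod_sum[OF y] mult_mat_vec_index_sum[OF A x] sum_distrib_right
        del: index_mult_mat_vec)
  also have "\<dots> = (\<Sum>k<N. \<Sum>i<N. A $$ (i, k) * x $ k * cnj (y $ i))"
    by (rule sum.swap)
  also have "\<dots> = (\<Sum>k<N. x $ k * cnj (\<Sum>i<N. mat_adjoint A $$ (k, i) * y $ i))"
    using A by (auto intro!: sum.cong simp: sum_distrib_left mat_adjoint_index mult_ac)
  also have "\<dots> = x \<bullet>c (mat_adjoint A *\<^sub>v y)"
    using A' y
    by (simp add: cscalar_prod_sum[of _ N] mult_mat_vec_index_sum[OF A' y]
        del: index_mult_mat_vec)
  finally show ?thesis .
qed

section \<open>Pauli strings\<close>

lemma mat2_eqI:
  assumes "A \<in> carrier_mat 2 2" "B \<in> carrier_mat 2 2"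
    "A $$ (0, 0) = B $$ (0, 0)" "A $$ (0, 1) = B $$ (0, 1)"
    "A $$ (1, 0) = B $$ (1, 0)" "A $$ (1, 1) = B $$ (1, 1)"
  shows "A = B"
  using assms by (auto intro!: eq_matI simp: less_2_cases_iff)

text \<open>Together with \<open>mat2_smult\<close>, \<open>mat2_eq_iff\<close> and
  \<open>mat2_adjoint\<close> this reduces every identity between Pauli matrices to four scalar
  equations, settled by a finite case split.\<close>

lemma mat2_mult:
  "mat_of_rows_list 2 [[a, b], [c, d]] * mat_of_rows_list 2 [[e, f], [g, h :: complex]] =
   mat_of_rows_list 2 [[a * e + b * g, a * f + b * h], [c * e + d * g, c * f + d * h]]"
  by (rule mat2_eqI) (auto simp: mat_of_rows_list_def scalar_prod_def)

lemma mat2_smult: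
  "k \<cdot>\<^sub>m mat_of_rows_list 2 [[a, b], [c, d :: complex]] =
   mat_of_rows_list 2 [[k * a, k * b], [k * c, k * d]]"
  by (rule mat2_eqI) (auto simp: mat_of_rows_list_def)

lemma mat2_eq_iff:
  "mat_of_rows_list 2 [[a, b], [c, d]] = mat_of_rows_list 2 [[e, f], [g, h :: complex]] \<longleftrightarrow>
   a = e \<and> b = f \<and> c = g \<and> d = h" (is "?A = ?B \<longleftrightarrow> ?R")
proof
  assume eq: "?A = ?B"
  have "?A $$ (0, 0) = ?B $$ (0, 0)" "?A $$ (0, 1) = ?B $$ (0, 1)"
    "?A $$ (1, 0) = ?B $$ (1, 0)" "?A $$ (1, 1) = ?B $$ (1, 1)" unfolding eq by auto
  then show ?R by (auto simp: mat_of_rows_list_def)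
qed auto

lemma mat2_one: "1\<^sub>m 2 = mat_of_rows_list 2 [[1, 0], [0, 1 :: complex]]"
  by (rule mat2_eqI) (auto simp: mat_of_rows_list_def)

lemma mat2_adjoint:
  "mat_adjoint (mat_of_rows_list 2 [[a, b], [c, d]]) =
   mat_of_rows_list 2 [[cnj a, cnj c], [cnj b, cnj d]]"
  by (rule mat2_eqI) (auto simp: mat_of_rows_list_def mat_adjoint_index intro!: carrier_matI)

lemmas pauli_mat2 = paulis_def mat2_one pauli_x_def pauli_y_def pauli_z_def

lemma paulis_carrier: "\<sigma> \<in> paulis \<Longrightarrow> \<sigma> \<in> carrier_mat 2 2"
  by (auto simp: paulis_def pauli_x_def pauli_y_def pauli_z_def mat_of_rows_list_def)

lemma paulis_adjoint: "\<sigma> \<in> paulis \<Longrightarrow> mat_adjoint \<sigma> = \<sigma>"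
  by (auto simp: pauli_mat2 mat2_adjoint)

lemma paulis_square: "\<sigma> \<in> paulis \<Longrightarrow> \<sigma> * \<sigma> = 1\<^sub>m 2"
  by (auto simp: pauli_mat2 mat2_mult mat2_eq_iff)

lemma paulis_commute:
  "\<sigma> \<in> paulis \<Longrightarrow> \<tau> \<in> paulis \<Longrightarrow> \<exists>c\<in>{1, - 1}. \<sigma> * \<tau> = c \<cdot>\<^sub>m (\<tau> * \<sigma>)"
  by (auto simp: pauli_mat2 mat2_mult mat2_smult mat2_eq_iff)

lemma paulis_mult:
  "\<sigma> \<in> paulis \<Longrightarrow> \<tau> \<in> paulis \<Longrightarrow> \<exists>k. \<exists>\<rho>\<in>paulis. \<sigma> * \<tau> = \<i> ^ k \<cdot>\<^sub>m \<rho>"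
proof -
  assume "\<sigma> \<in> paulis" "\<tau> \<in> paulis"
  \<comment> \<open>The only phases of such products are 1, \<i> and -\<i>; naming the finitely many
    exponents lets the case split find the right one.\<close>
  then have "\<exists>k\<in>{0, 1, 3}. \<exists>\<rho>\<in>paulis. \<sigma> * \<tau> = \<i> ^ k \<cdot>\<^sub>m \<rho>"
    by (auto simp: pauli_mat2 mat2_mult mat2_smult mat2_eq_iff power3_eq_cube)
  then show ?thesis by blast
qed

text \<open>Diagonal and antidiagonal Pauli matrices have different supports, and within each kind
  the ratio of the two nonzero entries is 1 for one matrix and -1 for the other.\<close>

lemma paulis_proportional:
  "\<sigma> \<in> paulis \<Longrightarrow> \<tau> \<in> paulis \<Longrightarrow> \<sigma> = c \<cdot>\<^sub>m \<tau> \<Longrightarrow> \<sigma> = \<tau>"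
  by (auto simp: pauli_mat2 mat2_smult mat2_eq_iff)

lemma tensor_Cons: "tensor (\<sigma> # \<sigma>s) = kronecker \<sigma> (tensor \<sigma>s)"
  by (simp add: tensor_def)

lemma pauli_strings_0: "\<sigma>s \<in> pauli_strings 0 \<longleftrightarrow> \<sigma>s = []"
  by (auto simp: pauli_strings_def)

lemma pauli_strings_Suc:
  "\<sigma>s \<in> pauli_strings (Suc n) \<longleftrightarrow> (\<exists>\<sigma>\<in>paulis. \<exists>\<tau>s\<in>pauli_strings n. \<sigma>s = \<sigma> # \<tau>s)"
  by (auto simp: pauli_strings_def length_Suc_conv)

lemma tensor_carrier: "\<sigma>s \<in> pauli_strings n \<Longrightarrow> tensor \<sigma>s \<in> carrier_mat (2 ^ n) (2 ^ n)"
proof (induction n arbitrary: \<sigma>s)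
  case 0
  then show ?case by (simp add: pauli_strings_0 tensor_def)
next
  case (Suc n)
  then show ?case
    by (auto simp: pauli_strings_Suc tensor_Cons intro!: kronecker_carrier paulis_carrier)
qed

lemma tensor_adjoint: "\<sigma>s \<in> pauli_strings n \<Longrightarrow> mat_adjoint (tensor \<sigma>s) = tensor \<sigma>s"
proof (induction n arbitrary: \<sigma>s)
  case 0
  then show ?case
    by (auto simp: pauli_strings_0 tensor_def mat_adjoint_index intro!: eq_matI)
next
  case (Suc n)
  then show ?case
    by (auto simp: pauli_strings_Suc tensor_Cons mat_adjoint_kronecker paulis_adjoint)
qed

lemma tensor_Cons_mult:
  assumes "\<sigma> \<in> paulis" "\<tau> \<in> paulis" "\<sigma>s \<in> pauli_strings n" "\<tau>s \<in> pauli_strings n"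
  shows "tensor (\<sigma> # \<sigma>s) * tensor (\<tau> # \<tau>s) = kronecker (\<sigma> * \<tau>) (tensor \<sigma>s * tensor \<tau>s)"
  unfolding tensor_Cons using assms
  by (intro kronecker_mult[OF paulis_carrier paulis_carrier tensor_carrier tensor_carrier])

lemma tensor_square: "\<sigma>s \<in> pauli_strings n \<Longrightarrow> tensor \<sigma>s * tensor \<sigma>s = 1\<^sub>m (2 ^ n)"
proof (induction n arbitrary: \<sigma>s)
  case 0
  then show ?case by (simp add: pauli_strings_0 tensor_def)
next
  case (Suc n)
  then show ?case
    by (auto simp: pauli_strings_Suc tensor_Cons_mult paulis_square kronecker_one)
qed

text \<open>Each tensor factor contributes a sign, and the signs multiply by
  \<open>kronecker_smult\<close>.\<close>

lemma tensor_commute: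
  "\<sigma>s \<in> pauli_strings n \<Longrightarrow> \<tau>s \<in> pauli_strings n \<Longrightarrow>
   \<exists>c\<in>{1, - 1}. tensor \<sigma>s * tensor \<tau>s = c \<cdot>\<^sub>m (tensor \<tau>s * tensor \<sigma>s)"
proof (induction n arbitrary: \<sigma>s \<tau>s)
  case 0
  then show ?case by (auto simp: pauli_strings_0 tensor_def)
next
  case (Suc n)
  then obtain \<sigma> \<tau> \<sigma>s' \<tau>s' where eq: "\<sigma>s = \<sigma> # \<sigma>s'" "\<tau>s = \<tau> # \<tau>s'"
    and p: "\<sigma> \<in> paulis" "\<tau> \<in> paulis" "\<sigma>s' \<in> pauli_strings n" "\<tau>s' \<in> pauli_strings n"
    by (auto simp: pauli_strings_Suc)
  obtain a b where ab: "a \<in> {1, - 1}" "b \<in> {1, - 1}" "\<sigma> * \<tau> = a \<cdot>\<^sub>m (\<tau> * \<sigma>)"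
      "tensor \<sigma>s' * tensor \<tau>s' = b \<cdot>\<^sub>m (tensor \<tau>s' * tensor \<sigma>s')"
    using paulis_commute[OF p(1,2)] Suc.IH[OF p(3,4)] by blast
  have "tensor \<sigma>s * tensor \<tau>s = (a * b) \<cdot>\<^sub>m (tensor \<tau>s * tensor \<sigma>s)"
    unfolding eq using p by (simp add: tensor_Cons_mult ab(3,4) kronecker_smult)
  moreover have "a * b \<in> {1, - 1}" using ab(1,2) by auto
  ultimately show ?case by blast
qed

text \<open>The phases of the factors multiply, so their exponents add; \<open>k\<close> is left
  unbounded for this reason and is reduced modulo 4 only in \<open>pauli_ops_iff\<close>.\<close>

lemma tensor_mult:
  "\<sigma>s \<in> pauli_strings n \<Longrightarrow> \<tau>s \<in> pauli_strings n \<Longrightarrow>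
   \<exists>k. \<exists>\<rho>s\<in>pauli_strings n. tensor \<sigma>s * tensor \<tau>s = \<i> ^ k \<cdot>\<^sub>m tensor \<rho>s"
proof (induction n arbitrary: \<sigma>s \<tau>s)
  case 0
  then show ?case by (auto simp: pauli_strings_0 tensor_def intro!: exI[of _ 0])
next
  case (Suc n)
  then obtain \<sigma> \<tau> \<sigma>s' \<tau>s' where eq: "\<sigma>s = \<sigma> # \<sigma>s'" "\<tau>s = \<tau> # \<tau>s'"
    and p: "\<sigma> \<in> paulis" "\<tau> \<in> paulis" "\<sigma>s' \<in> pauli_strings n" "\<tau>s' \<in> pauli_strings n"
    by (auto simp: pauli_strings_Suc)
  obtain k l \<rho> \<rho>s where kl: "\<rho> \<in> paulis" "\<rho>s \<in> pauli_strings n" "\<sigma> * \<tau> = \<i> ^ k \<cdot>\<^sub>m \<rho>"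
      "tensor \<sigma>s' * tensor \<tau>s' = \<i> ^ l \<cdot>\<^sub>m tensor \<rho>s"
    using paulis_mult[OF p(1,2)] Suc.IH[OF p(3,4)] by blast
  have "tensor \<sigma>s * tensor \<tau>s = \<i> ^ (k + l) \<cdot>\<^sub>m tensor (\<rho> # \<rho>s)"
    unfolding eq using p
    by (simp add: tensor_Cons_mult kl(3,4) kronecker_smult power_add) (simp add: tensor_Cons)
  moreover have "\<rho> # \<rho>s \<in> pauli_strings (Suc n)" using kl(1,2) by (auto simp: pauli_strings_Suc)
  ultimately show ?case by blast
qed

text \<open>The top left entry of \<open>A * A\<close> is 1, so row 0 of \<open>A\<close> cannot
  vanish.\<close>

lemma nonzero_entry_if_square_one:
  fixes A :: "complex mat"
  assumes A: "A \<in> carrier_mat N N" and sq: "A * A = 1\<^sub>m N" and N: "0 < N"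
  obtains i j where "i < N" "j < N" "A $$ (i, j) \<noteq> 0"
proof -
  have "(\<Sum>k<N. A $$ (0, k) * A $$ (k, 0)) = 1"
    using mult_mat_index_sum[OF A A N N] sq N by simp
  then obtain k where "k < N" "A $$ (0, k) * A $$ (k, 0) \<noteq> 0"
    by (metis (no_types, lifting) lessThan_iff sum.neutral zero_neq_one)
  then show ?thesis using that N by auto
qed

text \<open>Comparing blocks, \<open>\<sigma> \<otimes> A = c (\<tau> \<otimes> B)\<close> forces \<open>\<sigma>\<close> to be proportional to \<open>\<tau>\<close>, hence
  equal to it, and then \<open>A\<close> to be proportional to \<open>B\<close>.\<close>

lemma tensor_proportional:
  "\<sigma>s \<in> pauli_strings n \<Longrightarrow> \<tau>s \<in> pauli_strings n \<Longrightarrow> tensor \<sigma>s = c \<cdot>\<^sub>m tensor \<tau>s \<Longrightarrow> \<sigma>s = \<tau>s"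
proof (induction n arbitrary: \<sigma>s \<tau>s)
  case 0
  then show ?case by (simp add: pauli_strings_0)
next
  case (Suc n)
  then obtain \<sigma> \<tau> \<sigma>s' \<tau>s' where eq: "\<sigma>s = \<sigma> # \<sigma>s'" "\<tau>s = \<tau> # \<tau>s'"
    and p: "\<sigma> \<in> paulis" "\<tau> \<in> paulis" "\<sigma>s' \<in> pauli_strings n" "\<tau>s' \<in> pauli_strings n"
    by (auto simp: pauli_strings_Suc)
  let ?N = "2 ^ n :: nat"
  note \<sigma> = paulis_carrier[OF p(1)] and \<tau> = paulis_carrier[OF p(2)]
    and A = tensor_carrier[OF p(3)] and B = tensor_carrier[OF p(4)]
  have entries: "\<sigma> $$ (i, j) * tensor \<sigma>s' $$ (k, l) = c * (\<tau> $$ (i, j) * tensor \<tau>s' $$ (k, l))"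
    if "i < 2" "j < 2" "k < ?N" "l < ?N" for i j k l
  proof -
    have b: "i * ?N + k < 2 * ?N" "j * ?N + l < 2 * ?N" using that by (simp_all add: block_index_less)
    have "kronecker \<sigma> (tensor \<sigma>s') $$ (i * ?N + k, j * ?N + l) =
          (c \<cdot>\<^sub>m kronecker \<tau> (tensor \<tau>s')) $$ (i * ?N + k, j * ?N + l)"
      using Suc.prems(3) by (simp add: eq tensor_Cons)
    also have "\<dots> = c * kronecker \<tau> (tensor \<tau>s') $$ (i * ?N + k, j * ?N + l)"
      using kronecker_carrier[OF \<tau> B] b by simp
    finally show ?thesis
      by (simp only: kronecker_index[OF \<sigma> A that] kronecker_index[OF \<tau> B that])
  qed
  obtain k l where kl: "k < ?N" "l < ?N" "tensor \<sigma>s' $$ (k, l) \<noteq> 0"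
    using nonzero_entry_if_square_one[OF A tensor_square[OF p(3)]] by auto
  \<comment> \<open>This ratio comes from \<open>entries\<close> at the fixed position
    \<open>(k, l)\<close> of each block, divided by the nonzero entry of the tail there.\<close>
  let ?x = "c * tensor \<tau>s' $$ (k, l) / tensor \<sigma>s' $$ (k, l)"
  have "\<sigma> = ?x \<cdot>\<^sub>m \<tau>"
    using \<sigma> \<tau> entries[OF _ _ kl(1,2)] kl(3)
    by (intro eq_matI) (auto simp: field_simps)
  then have [simp]: "\<sigma> = \<tau>" by (rule paulis_proportional[OF p(1,2)])
  obtain i j where ij: "i < 2" "j < 2" "\<tau> $$ (i, j) \<noteq> 0"
    using nonzero_entry_if_square_one[OF \<tau> paulis_square[OF p(2)]] by auto
  \<comment> \<open>The nonzero entry of the common first factor cancels, so the scalar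
    \<open>c\<close> passes to the tails unchanged and the induction hypothesis applies with the
    same \<open>c\<close>.\<close>
  have "tensor \<sigma>s' = c \<cdot>\<^sub>m tensor \<tau>s'"
    using A B entries[OF ij(1,2)] ij(3) by (intro eq_matI) (auto simp: mult.left_commute)
  then show ?case using Suc.IH[OF p(3,4)] by (simp add: eq)
qed

section \<open>Error operators and Pauli operators with phases\<close>

lemma error_ops_carrier: "\<alpha> \<in> error_ops n \<Longrightarrow> \<alpha> \<in> carrier_mat (2 ^ n) (2 ^ n)"
  by (auto simp: error_ops_def tensor_carrier)

lemma error_ops_adjoint: "\<alpha> \<in> error_ops n \<Longrightarrow> mat_adjoint \<alpha> = \<alpha>"
  by (auto simp: error_ops_def tensor_adjoint)

lemma error_ops_square: "\<alpha> \<in> error_ops n \<Longrightarrow> \<alpha> * \<alpha> = 1\<^sub>m (2 ^ n)"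
  by (auto simp: error_ops_def tensor_square)

lemma error_ops_commute:
  "\<alpha> \<in> error_ops n \<Longrightarrow> \<beta> \<in> error_ops n \<Longrightarrow> \<exists>c\<in>{1, - 1}. \<alpha> * \<beta> = c \<cdot>\<^sub>m (\<beta> * \<alpha>)"
  using tensor_commute by (auto simp: error_ops_def)

text \<open>The fact behind the well-definedness of \<open>forget_phase\<close>: a Pauli operator
  has only one phase-free representative.\<close>

lemma error_ops_proportional:
  "\<alpha> \<in> error_ops n \<Longrightarrow> \<beta> \<in> error_ops n \<Longrightarrow> \<alpha> = c \<cdot>\<^sub>m \<beta> \<Longrightarrow> \<alpha> = \<beta>"
  by (auto simp: error_ops_def dest: tensor_proportional[OF _ _ sym])

lemma finite_error_ops: "finite (error_ops n)"
proof -
  have "finite {\<sigma>s. set \<sigma>s \<subseteq> paulis \<and> length \<sigma>s = n}"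
    by (rule finite_lists_length_eq) (simp add: paulis_def)
  then show ?thesis by (simp add: error_ops_def pauli_strings_def conj_commute)
qed

lemma imaginary_unit_power_mod: "\<i> ^ k = \<i> ^ (k mod 4)"
proof -
  have "\<i> ^ k = \<i> ^ (4 * (k div 4) + k mod 4)" by simp
  also have "\<dots> = (\<i> ^ 4) ^ (k div 4) * \<i> ^ (k mod 4)" by (simp only: power_add power_mult)
  also have "\<i> ^ 4 = 1" by (simp add: power4_eq_xxxx)
  finally show ?thesis by simp
qed

lemma mod_4_mem: "k mod 4 \<in> {0, 1, 2, 3 :: nat}"
proof -
  have "k mod 4 < 4" by simp
  then show ?thesis by (simp only: insert_iff empty_iff) linarith
qed

lemma imaginary_unit_power_smult_mod: "\<i> ^ k \<cdot>\<^sub>m A = \<i> ^ (k mod 4) \<cdot>\<^sub>m A"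
  by (rule arg_cong[OF imaginary_unit_power_mod])

text \<open>With arbitrary exponents, products of phases can be handled by adding exponents;
  periodicity of the powers of \<i> leads back to the four listed ones.\<close>

lemma pauli_ops_iff: "\<beta> \<in> pauli_ops n \<longleftrightarrow> (\<exists>k. \<exists>\<alpha>\<in>error_ops n. \<beta> = \<i> ^ k \<cdot>\<^sub>m \<alpha>)"
proof
  assume "\<exists>k. \<exists>\<alpha>\<in>error_ops n. \<beta> = \<i> ^ k \<cdot>\<^sub>m \<alpha>"
  then obtain k \<alpha> where a: "\<alpha> \<in> error_ops n" "\<beta> = \<i> ^ k \<cdot>\<^sub>m \<alpha>" by blast
  show "\<beta> \<in> pauli_ops n"
    unfolding pauli_ops_def mem_Collect_eq
    by (intro exI conjI, rule trans[OF a(2) imaginary_unit_power_smult_mod], rule mod_4_mem, rule a(1))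
next
  assume "\<beta> \<in> pauli_ops n"
  then show "\<exists>k. \<exists>\<alpha>\<in>error_ops n. \<beta> = \<i> ^ k \<cdot>\<^sub>m \<alpha>" unfolding pauli_ops_def by blast
qed

lemma pauli_opsE:
  assumes "\<beta> \<in> pauli_ops n"
  obtains k \<alpha> where "\<alpha> \<in> error_ops n" "\<beta> = \<i> ^ k \<cdot>\<^sub>m \<alpha>"
  using assms pauli_ops_iff by blast

lemma error_ops_subset_pauli_ops: "error_ops n \<subseteq> pauli_ops n"
proof
  fix \<alpha> assume "\<alpha> \<in> error_ops n"
  moreover have "\<alpha> = \<i> ^ 0 \<cdot>\<^sub>m \<alpha>" by auto
  ultimately show "\<alpha> \<in> pauli_ops n" unfolding pauli_ops_iff by blast
qed

lemma finite_pauli_ops: "finite (pauli_ops n)"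
proof -
  have "pauli_ops n = (\<lambda>(k, \<alpha>). \<i> ^ k \<cdot>\<^sub>m \<alpha>) ` ({0, 1, 2, 3} \<times> error_ops n)"
    unfolding pauli_ops_def by auto
  then show ?thesis using finite_error_ops by simp
qed

lemma pauli_ops_carrier: "\<beta> \<in> pauli_ops n \<Longrightarrow> \<beta> \<in> carrier_mat (2 ^ n) (2 ^ n)"
  by (auto elim!: pauli_opsE dest: error_ops_carrier)

lemma smult_mult_smult:
  fixes A B :: "'a::comm_ring_1 mat"
  assumes "A \<in> carrier_mat N N" "B \<in> carrier_mat N N"
  shows "(a \<cdot>\<^sub>m A) * (b \<cdot>\<^sub>m B) = (a * b) \<cdot>\<^sub>m (A * B)"
  using assms by (auto simp: mult_smult_distrib[of _ N N _ N] mult_smult_assoc_mat[of _ N N _ N] mult.commute)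

lemma smult_mult_mat_vec:
  fixes A :: "'a::comm_ring_1 mat"
  assumes "A \<in> carrier_mat N N" "x \<in> carrier_vec N"
  shows "(k \<cdot>\<^sub>m A) *\<^sub>v x = k \<cdot>\<^sub>v (A *\<^sub>v x)"
  using assms by (intro eq_vecI) (auto simp: scalar_prod_smult_left)

lemma pauli_ops_mult:
  assumes "\<beta> \<in> pauli_ops n" "\<gamma> \<in> pauli_ops n"
  shows "\<beta> * \<gamma> \<in> pauli_ops n"
proof -
  obtain k l \<sigma>s \<tau>s where s: "\<sigma>s \<in> pauli_strings n" "\<tau>s \<in> pauli_strings n"
    "\<beta> = \<i> ^ k \<cdot>\<^sub>m tensor \<sigma>s" "\<gamma> = \<i> ^ l \<cdot>\<^sub>m tensor \<tau>s"
    using assms by (auto elim!: pauli_opsE simp: error_ops_def)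
  obtain m \<rho>s where r: "\<rho>s \<in> pauli_strings n" "tensor \<sigma>s * tensor \<tau>s = \<i> ^ m \<cdot>\<^sub>m tensor \<rho>s"
    using tensor_mult[OF s(1,2)] by blast
  have "\<beta> * \<gamma> = (\<i> ^ k * \<i> ^ l) \<cdot>\<^sub>m (\<i> ^ m \<cdot>\<^sub>m tensor \<rho>s)"
    unfolding s(3,4) r(2)[symmetric]
    using s(1,2) by (intro smult_mult_smult[of _ "2 ^ n"] tensor_carrier)
  also have "\<dots> = \<i> ^ (k + l + m) \<cdot>\<^sub>m tensor \<rho>s"
    by (auto simp: power_add)
  finally show ?thesis using r(1) unfolding pauli_ops_iff error_ops_def by blast
qed

text \<open>The parity of \<open>k\<close> decides between the squares \<open>I\<close> and
  \<open>-I\<close>, and the second is impossible inside a stabilizer group.\<close>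

lemma pauli_ops_square:
  assumes "\<alpha> \<in> error_ops n"
  shows "(\<i> ^ k \<cdot>\<^sub>m \<alpha>) * (\<i> ^ k \<cdot>\<^sub>m \<alpha>) = (- 1) ^ k \<cdot>\<^sub>m 1\<^sub>m (2 ^ n)"
  using error_ops_carrier[OF assms] error_ops_square[OF assms]
  by (simp add: smult_mult_smult[of _ "2 ^ n"] power_mult_distrib[symmetric])

lemma pauli_ops_commute:
  assumes "\<beta> \<in> pauli_ops n" "\<gamma> \<in> pauli_ops n"
  shows "\<exists>c\<in>{1, - 1}. \<beta> * \<gamma> = c \<cdot>\<^sub>m (\<gamma> * \<beta>)"
proof -
  obtain k l \<alpha> \<alpha>' where s: "\<alpha> \<in> error_ops n" "\<alpha>' \<in> error_ops n"
    "\<beta> = \<i> ^ k \<cdot>\<^sub>m \<alpha>" "\<gamma> = \<i> ^ l \<cdot>\<^sub>m \<alpha>'"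
    using assms by (auto elim!: pauli_opsE)
  obtain c where c: "c \<in> {1, - 1}" "\<alpha> * \<alpha>' = c \<cdot>\<^sub>m (\<alpha>' * \<alpha>)"
    using error_ops_commute[OF s(1,2)] by blast
  have "\<beta> * \<gamma> = c \<cdot>\<^sub>m (\<gamma> * \<beta>)"
    unfolding s(3,4) using error_ops_carrier[OF s(1)] error_ops_carrier[OF s(2)]
    by (auto simp: smult_mult_smult[of _ "2 ^ n"] c(2) mult_ac)
  then show ?thesis using c(1) by blast
qed

lemma one_smult_mat: "1 \<cdot>\<^sub>m A = (A :: complex mat)"
  by (intro eq_matI) auto

lemma minus_one_smult_mat: "(- 1) \<cdot>\<^sub>m A = - (A :: complex mat)"
  by (intro eq_matI) auto

text \<open>Applied to a product of two Pauli operators, this shows that commuting and anticommuting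
  exclude each other. A Pauli operator has a nonzero entry, which differs from its negative.\<close>

lemma pauli_ops_neq_uminus:
  assumes "\<beta> \<in> pauli_ops n"
  shows "\<beta> \<noteq> - \<beta>"
proof
  assume eq: "\<beta> = - \<beta>"
  obtain k \<alpha> where a: "\<alpha> \<in> error_ops n" "\<beta> = \<i> ^ k \<cdot>\<^sub>m \<alpha>" using assms by (rule pauli_opsE)
  obtain i j where ij: "i < 2 ^ n" "j < 2 ^ n" "\<alpha> $$ (i, j) \<noteq> 0"
    using nonzero_entry_if_square_one[OF error_ops_carrier[OF a(1)] error_ops_square[OF a(1)]] by auto
  have "\<beta> $$ (i, j) = - (\<beta> $$ (i, j))"
    using ij pauli_ops_carrier[OF assms] by (subst eq) simp
  then have "\<beta> $$ (i, j) = 0" by simp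
  then show False using ij error_ops_carrier[OF a(1)] a(2) by simp
qed

text \<open>Existence follows by reducing \<open>k\<close> modulo 4, uniqueness from
  \<open>error_ops_proportional\<close> after dividing by the phase.\<close>

lemma forget_phase_smult:
  assumes "\<alpha> \<in> error_ops n"
  shows "forget_phase n (\<i> ^ k \<cdot>\<^sub>m \<alpha>) = \<alpha>"
  unfolding forget_phase_def
proof (rule the_equality)
  show "\<alpha> \<in> error_ops n \<and> (\<exists>l\<in>{0, 1, 2, 3}. \<i> ^ k \<cdot>\<^sub>m \<alpha> = \<i> ^ l \<cdot>\<^sub>m \<alpha>)"
    using assms imaginary_unit_power_smult_mod mod_4_mem by blast
next
  fix \<beta>
  assume "\<beta> \<in> error_ops n \<and> (\<exists>l\<in>{0, 1, 2, 3}. \<i> ^ k \<cdot>\<^sub>m \<alpha> = \<i> ^ l \<cdot>\<^sub>m \<beta>)"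
  then obtain l where b: "\<beta> \<in> error_ops n" "\<i> ^ k \<cdot>\<^sub>m \<alpha> = \<i> ^ l \<cdot>\<^sub>m \<beta>" by blast
  have "\<beta> = inverse (\<i> ^ l) \<cdot>\<^sub>m (\<i> ^ l \<cdot>\<^sub>m \<beta>)" by auto
  then have "\<beta> = (inverse (\<i> ^ l) * \<i> ^ k) \<cdot>\<^sub>m \<alpha>" unfolding b(2)[symmetric] by auto
  then show "\<beta> = \<alpha>" by (rule error_ops_proportional[OF b(1) assms])
qed

section \<open>Action of Pauli operators on states\<close>

lemma cscalar_prod_smult:
  fixes x y :: "complex vec"
  assumes "x \<in> carrier_vec N" "y \<in> carrier_vec N"
  shows "(a \<cdot>\<^sub>v x) \<bullet>c (b \<cdot>\<^sub>v y) = a * cnj b * (x \<bullet>c y)"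
  using assms by (simp add: conjugate_smult_vec)

text \<open>The phase has modulus one, and an error operator is Hermitian with square the identity,
  hence unitary.\<close>

lemma pauli_ops_isometry:
  assumes w: "\<omega> \<in> pauli_ops n" and x: "x \<in> carrier_vec (2 ^ n)" and y: "y \<in> carrier_vec (2 ^ n)"
  shows "(\<omega> *\<^sub>v x) \<bullet>c (\<omega> *\<^sub>v y) = x \<bullet>c y"
proof -
  obtain k \<alpha> where a: "\<alpha> \<in> error_ops n" "\<omega> = \<i> ^ k \<cdot>\<^sub>m \<alpha>" using w by (rule pauli_opsE)
  note ac = error_ops_carrier[OF a(1)]
  have "\<i> ^ k * cnj (\<i> ^ k) = 1"
    by (simp add: power_mult_distrib[symmetric])
  then have "(\<omega> *\<^sub>v x) \<bullet>c (\<omega> *\<^sub>v y) = (\<alpha> *\<^sub>v x) \<bullet>c (\<alpha> *\<^sub>v y)"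
    unfolding a(2) smult_mult_mat_vec[OF ac x] smult_mult_mat_vec[OF ac y]
    using ac x y by (subst cscalar_prod_smult[of _ "2 ^ n"]) auto
  also have "\<dots> = x \<bullet>c ((\<alpha> * \<alpha>) *\<^sub>v y)"
    using ac x y by (simp add: cscalar_prod_adjoint[of _ "2 ^ n"] error_ops_adjoint[OF a(1)])
  finally show ?thesis using y error_ops_square[OF a(1)] by simp
qed

text \<open>Moving \<open>\<beta>\<close> past \<open>\<omega>\<close> costs the sign
  \<open>c\<close>; afterwards \<open>\<omega>\<close> stands on both sides of the scalar product
  and cancels as an isometry.\<close>

lemma pauli_ops_conjugate_expectation:
  assumes w: "\<omega> \<in> pauli_ops n" and b: "\<beta> \<in> carrier_mat (2 ^ n) (2 ^ n)"
    and x: "x \<in> carrier_vec (2 ^ n)"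
    and c: "c \<in> {1, - 1}" "\<omega> * \<beta> = c \<cdot>\<^sub>m (\<beta> * \<omega>)"
  shows "(\<beta> *\<^sub>v (\<omega> *\<^sub>v x)) \<bullet>c (\<omega> *\<^sub>v x) = c * ((\<beta> *\<^sub>v x) \<bullet>c x)"
proof -
  note wc = pauli_ops_carrier[OF w]
  have "c * c = 1" using c(1) by auto
  then have swap: "\<beta> * \<omega> = c \<cdot>\<^sub>m (\<omega> * \<beta>)" unfolding c(2) by (intro eq_matI) (simp_all add: mult.assoc[symmetric])
  have "\<beta> *\<^sub>v (\<omega> *\<^sub>v x) = (\<beta> * \<omega>) *\<^sub>v x"
    by (rule assoc_mult_mat_vec[symmetric, OF b wc x])
  also have "\<dots> = c \<cdot>\<^sub>v ((\<omega> * \<beta>) *\<^sub>v x)"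
    unfolding swap by (rule smult_mult_mat_vec[OF mult_carrier_mat[OF wc b] x])
  also have "(\<omega> * \<beta>) *\<^sub>v x = \<omega> *\<^sub>v (\<beta> *\<^sub>v x)"
    by (rule assoc_mult_mat_vec[OF wc b x])
  finally have "(\<beta> *\<^sub>v (\<omega> *\<^sub>v x)) \<bullet>c (\<omega> *\<^sub>v x) = c * ((\<omega> *\<^sub>v (\<beta> *\<^sub>v x)) \<bullet>c (\<omega> *\<^sub>v x))"
    using wc b x by simp
  also have "(\<omega> *\<^sub>v (\<beta> *\<^sub>v x)) \<bullet>c (\<omega> *\<^sub>v x) = (\<beta> *\<^sub>v x) \<bullet>c x"
    using b x by (intro pauli_ops_isometry[OF w]) auto
  finally show ?thesis .
qed

section \<open>Stabilizer states\<close>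

lemma stabilizer_groupD:
  assumes "stabilizer_group n S"
  shows "S \<subseteq> pauli_ops n" "1\<^sub>m (2 ^ n) \<in> S" "s \<in> S \<Longrightarrow> t \<in> S \<Longrightarrow> s * t \<in> S"
    "s \<in> S \<Longrightarrow> t \<in> S \<Longrightarrow> s * t = t * s" "- 1\<^sub>m (2 ^ n) \<notin> S"
  using assms by (auto simp: stabilizer_group_def subgroup_def pauli_group_def)

text \<open>A Pauli operator squares to \<open>I\<close> or \<open>-I\<close>; the square of
  \<open>s\<close> lies in \<open>S\<close>, and \<open>-I\<close> does not.\<close>

lemma stabilizer_group_square:
  assumes S: "stabilizer_group n S" and s: "s \<in> S"
  shows "s * s = 1\<^sub>m (2 ^ n)"
proof -
  obtain k \<alpha> where a: "\<alpha> \<in> error_ops n" "s = \<i> ^ k \<cdot>\<^sub>m \<alpha>"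
    using stabilizer_groupD(1)[OF S] s by (meson pauli_opsE subsetD)
  then have sq: "s * s = (- 1) ^ k \<cdot>\<^sub>m 1\<^sub>m (2 ^ n)" using pauli_ops_square by simp
  have "s * s \<noteq> - 1\<^sub>m (2 ^ n)" using stabilizer_groupD(3,5)[OF S] s by metis
  then have "even k" using sq by (cases "even k") (auto simp: minus_one_smult_mat)
  then show ?thesis using sq by (simp add: one_smult_mat)
qed

text \<open>Every element is its own inverse, so closure under products already gives closure under
  inverses. The definite description of the inverse is evaluated directly: \<open>t * y = 1\<close>
  and \<open>t * t = 1\<close> give \<open>y = t\<close>.\<close>

lemma stabilizer_group_if_involutive:
  assumes T: "T \<subseteq> pauli_ops n" and one: "1\<^sub>m (2 ^ n) \<in> T"
    and mult: "\<And>s t. s \<in> T \<Longrightarrow> t \<in> T \<Longrightarrow> s * t \<in> T"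
    and comm: "\<And>s t. s \<in> T \<Longrightarrow> t \<in> T \<Longrightarrow> s * t = t * s"
    and sq: "\<And>t. t \<in> T \<Longrightarrow> t * t = 1\<^sub>m (2 ^ n)"
    and neg: "- 1\<^sub>m (2 ^ n) \<notin> T"
  shows "stabilizer_group n T"
proof -
  have "inv\<^bsub>pauli_group n\<^esub> t = t" if t: "t \<in> T" for t
    unfolding m_inv_def
  proof (rule the_equality)
    show "t \<in> carrier (pauli_group n) \<and> t \<otimes>\<^bsub>pauli_group n\<^esub> t = \<one>\<^bsub>pauli_group n\<^esub> \<and>
          t \<otimes>\<^bsub>pauli_group n\<^esub> t = \<one>\<^bsub>pauli_group n\<^esub>"
      using t T sq by (auto simp: pauli_group_def)
  next
    fix y
    assume "y \<in> carrier (pauli_group n) \<and> t \<otimes>\<^bsub>pauli_group n\<^esub> y = \<one>\<^bsub>pauli_group n\<^esub> \<and>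
            y \<otimes>\<^bsub>pauli_group n\<^esub> t = \<one>\<^bsub>pauli_group n\<^esub>"
    then have y: "y \<in> pauli_ops n" "t * y = 1\<^sub>m (2 ^ n)" by (auto simp: pauli_group_def)
    have c: "t \<in> carrier_mat (2 ^ n) (2 ^ n)" "y \<in> carrier_mat (2 ^ n) (2 ^ n)"
      using t T y(1) pauli_ops_carrier by auto
    have "y = (t * t) * y" using sq[OF t] c by simp
    also have "\<dots> = t" unfolding assoc_mult_mat[OF c(1) c(1) c(2)] y(2) using c by simp
    finally show "y = t" .
  qed
  then have "subgroup T (pauli_group n)"
    using T one mult by (auto simp: subgroup_def pauli_group_def)
  then show ?thesis using comm neg by (auto simp: stabilizer_group_def)
qed

text \<open>If \<open>\<beta> \<notin> \<phi>(S)\<close> commuted with all of \<open>S\<close>, then \<open>S \<union> \<beta>S\<close> would be a larger stabilizer group.\<close>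

lemma cws_group_anticommuting:
  assumes S: "cws_group n S" and b: "\<beta> \<in> error_ops n" and nb: "\<beta> \<notin> forget_phase n ` S"
  shows "\<exists>s\<in>S. s * \<beta> = - (\<beta> * s)"
proof (rule ccontr)
  assume na: "\<not> (\<exists>s\<in>S. s * \<beta> = - (\<beta> * s))"
  let ?N = "2 ^ n :: nat"
  have st: "stabilizer_group n S" using S by (simp add: cws_group_def)
  note D = stabilizer_groupD[OF st]
  have bP: "\<beta> \<in> pauli_ops n" using b error_ops_subset_pauli_ops by auto
  \<comment> \<open>Pauli operators commute or anticommute, and the second alternative is excluded
    by \<open>na\<close>.\<close>
  have com: "s * \<beta> = \<beta> * s" if "s \<in> S" for s
  proof -
    obtain c where "c \<in> {1, - 1}" "s * \<beta> = c \<cdot>\<^sub>m (\<beta> * s)"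
      using pauli_ops_commute[OF _ bP] D(1) \<open>s \<in> S\<close> by blast
    then show ?thesis using na \<open>s \<in> S\<close> by (auto simp: minus_one_smult_mat)
  qed
  have sc: "s \<in> carrier_mat ?N ?N" if "s \<in> S" for s using D(1) that pauli_ops_carrier by auto
  note bc = error_ops_carrier[OF b] and bsq = error_ops_square[OF b]
  note assoc = assoc_mult_mat[of _ ?N ?N _ ?N _ ?N]
  \<comment> \<open>Sliding \<open>\<beta>\<close> to the left and cancelling pairs of it reduces
    all products in the enlarged set to products in \<open>S\<close>.\<close>
  have swap: "s * (\<beta> * t) = \<beta> * (s * t)" if "s \<in> S" "t \<in> S" for s t
  proof -
    have "s * (\<beta> * t) = (s * \<beta>) * t"
      by (rule assoc[OF sc[OF that(1)] bc sc[OF that(2)], symmetric])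
    also have "\<dots> = \<beta> * (s * t)"
      unfolding com[OF that(1)] by (rule assoc[OF bc sc[OF that(1)] sc[OF that(2)]])
    finally show ?thesis .
  qed
  have cancel: "\<beta> * (\<beta> * A) = A" if "A \<in> carrier_mat ?N ?N" for A
    using assoc[OF bc bc that] bsq that by simp
  let ?T = "S \<union> (\<lambda>s. \<beta> * s) ` S"
  have prods: "(\<beta> * s) * t = \<beta> * (s * t)" "(\<beta> * s) * (\<beta> * t) = s * t" if "s \<in> S" "t \<in> S" for s t
    using sc[OF that(1)] sc[OF that(2)] bc swap[OF that] cancel[of "s * t"]
    by (simp_all add: assoc)
  have "stabilizer_group n ?T"
  proof (rule stabilizer_group_if_involutive)
    show "?T \<subseteq> pauli_ops n" using D(1) bP pauli_ops_mult by blast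
    show "1\<^sub>m ?N \<in> ?T" using D(2) by simp
    show "s * t \<in> ?T" if "s \<in> ?T" "t \<in> ?T" for s t
      using that D(3) by (auto simp: prods swap)
    show "s * t = t * s" if "s \<in> ?T" "t \<in> ?T" for s t
      using that D(4) by (auto simp: prods swap)
    show "t * t = 1\<^sub>m ?N" if "t \<in> ?T" for t
      using that stabilizer_group_square[OF st] by (auto simp: prods)
    show "- 1\<^sub>m ?N \<notin> ?T"
    proof
      assume "- 1\<^sub>m ?N \<in> ?T"
      then obtain s where s: "s \<in> S" "\<beta> * s = - 1\<^sub>m ?N" using D(5) by auto
      have "s = \<beta> * (- 1\<^sub>m ?N)" using cancel[OF sc[OF s(1)]] s(2) by simp
      \<comment> \<open>The sign is written as a power of \<i> so that
        \<open>forget_phase_smult\<close> applies and places \<open>\<beta>\<close> in the image of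
        \<open>S\<close>.\<close>
      also have "\<dots> = \<i> ^ 2 \<cdot>\<^sub>m \<beta>" using bc by (simp add: minus_one_smult_mat)
      finally have "s = \<i> ^ 2 \<cdot>\<^sub>m \<beta>" .
      then have "forget_phase n s = \<beta>" by (simp only: forget_phase_smult[OF b])
      then show False using nb s(1) by auto
    qed
  qed
  then have "?T = S" using S by (auto simp: cws_group_def)
  \<comment> \<open>The identity of \<open>S\<close> contributes \<open>\<beta>\<close> itself to
    the enlarged group, which equals \<open>S\<close> by maximality.\<close>
  moreover have "\<beta> * 1\<^sub>m ?N \<in> ?T" using D(2) by blast
  ultimately have "\<beta> \<in> S" using bc by simp
  moreover have "forget_phase n \<beta> = \<beta>"
    using forget_phase_smult[OF b, of 0] by (simp add: one_smult_mat)
  ultimately show False using nb by (metis imageI)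
qed

text \<open>Some \<open>s\<close> in \<open>S\<close> anticommutes with \<open>\<beta>\<close> and
  fixes \<open>\<psi>\<close>; conjugating by it shows that the expectation equals its own
  negative.\<close>

lemma stabilizer_expectation_eq_0:
  assumes S: "cws_group n S" and \<psi>: "stabilizer_state n S \<psi>"
    and b: "\<beta> \<in> error_ops n" and nb: "\<beta> \<notin> forget_phase n ` S"
  shows "(\<beta> *\<^sub>v \<psi>) \<bullet>c \<psi> = 0"
proof -
  obtain s where s: "s \<in> S" "s * \<beta> = - (\<beta> * s)" using cws_group_anticommuting[OF S b nb] by blast
  have "s \<in> pauli_ops n" using S s(1) stabilizer_groupD(1) by (auto simp: cws_group_def)
  moreover have "\<psi> \<in> carrier_vec (2 ^ n)" "s *\<^sub>v \<psi> = \<psi>" using \<psi> s(1) by (auto simp: stabilizer_state_def)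
  ultimately have "(\<beta> *\<^sub>v \<psi>) \<bullet>c \<psi> = - 1 * ((\<beta> *\<^sub>v \<psi>) \<bullet>c \<psi>)"
    using pauli_ops_conjugate_expectation[of s n \<beta> \<psi> "- 1"] error_ops_carrier[OF b] s(2)
    by (simp add: minus_one_smult_mat)
  then show ?thesis by simp
qed

text \<open>If \<open>s = \<i> ^ k \<cdot>\<^sub>m \<beta>\<close> fixes \<open>\<psi>\<close>, then
  \<i>^k times the expectation is 1, and \<open>s * s = 1\<close> makes the phase a sign. The square
  hides this sign, and only squares enter the enumerator.\<close>

lemma stabilizer_expectation_square:
  assumes S: "stabilizer_group n S" and \<psi>: "stabilizer_state n S \<psi>"
    and b: "\<beta> \<in> forget_phase n ` S"
  shows "((\<beta> *\<^sub>v \<psi>) \<bullet>c \<psi>)\<^sup>2 = 1"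
proof -
  obtain s where s: "s \<in> S" "\<beta> = forget_phase n s" using b by blast
  obtain k \<alpha> where a: "\<alpha> \<in> error_ops n" "s = \<i> ^ k \<cdot>\<^sub>m \<alpha>"
    using stabilizer_groupD(1)[OF S] s(1) by (meson pauli_opsE subsetD)
  have [simp]: "\<beta> = \<alpha>" using s(2) a forget_phase_smult by simp
  note ac = error_ops_carrier[OF a(1)]
  have p: "\<psi> \<in> carrier_vec (2 ^ n)" "\<psi> \<bullet>c \<psi> = 1" "s *\<^sub>v \<psi> = \<psi>"
    using \<psi> s(1) by (auto simp: stabilizer_state_def)
  have "(- 1) ^ k \<cdot>\<^sub>m 1\<^sub>m (2 ^ n) = (1\<^sub>m (2 ^ n) :: complex mat)"
    using stabilizer_group_square[OF S s(1)] pauli_ops_square[OF a(1), of k] a(2) by simp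
  then have "((- 1) ^ k \<cdot>\<^sub>m 1\<^sub>m (2 ^ n)) $$ (0, 0) = (1\<^sub>m (2 ^ n) :: complex mat) $$ (0, 0)" by simp
  then have k: "(- 1 :: complex) ^ k = 1" by simp
  have "\<i> ^ k * ((\<alpha> *\<^sub>v \<psi>) \<bullet>c \<psi>) = (s *\<^sub>v \<psi>) \<bullet>c \<psi>"
    using ac p(1) unfolding a(2) by (simp add: smult_mult_mat_vec[of _ "2 ^ n"])
  also have "\<dots> = 1" using p by simp
  finally have "(\<i> ^ k * ((\<alpha> *\<^sub>v \<psi>) \<bullet>c \<psi>))\<^sup>2 = 1" by simp
  moreover have "(\<i> ^ k)\<^sup>2 = 1" using k by (metis i_squared power_mult mult.commute power2_i)
  ultimately show ?thesis by (simp add: power_mult_distrib)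
qed

section \<open>Orthogonal projectors\<close>

text \<open>Linear combinations are indexed by \<open>I\<close>, so that sums over word operators
  can be used directly; \<open>lincomb\<close> of the library sums over a set of vectors
  instead.\<close>

definition superposition :: "nat \<Rightarrow> 'i set \<Rightarrow> ('i \<Rightarrow> complex vec) \<Rightarrow> ('i \<Rightarrow> complex) \<Rightarrow> complex vec" where
  "superposition N I v a = vec N (\<lambda>k. \<Sum>i\<in>I. a i * v i $ k)"

lemma superposition_carrier [simp]: "superposition N I v a \<in> carrier_vec N"
  by (simp add: superposition_def)

lemma mult_superposition_cscalar_prod:
  fixes A :: "complex mat"
  assumes A: "A \<in> carrier_mat N N" and v: "v ` I \<subseteq> carrier_vec N" and y: "y \<in> carrier_vec N"
  shows "(A *\<^sub>v superposition N I v a) \<bullet>c y = (\<Sum>i\<in>I. a i * ((A *\<^sub>v v i) \<bullet>c y))"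
proof -
  have "(A *\<^sub>v superposition N I v a) \<bullet>c y =
        (\<Sum>l<N. \<Sum>k<N. \<Sum>i\<in>I. a i * (A $$ (l, k) * v i $ k * cnj (y $ l)))"
    unfolding cscalar_prod_sum[OF y]
    by (intro sum.cong refl)
      (simp add: mult_mat_vec_index_sum[OF A] superposition_def sum_distrib_left sum_distrib_right
        mult_ac del: index_mult_mat_vec)
  also have "\<dots> = (\<Sum>l<N. \<Sum>i\<in>I. \<Sum>k<N. a i * (A $$ (l, k) * v i $ k * cnj (y $ l)))"
    by (intro sum.cong refl sum.swap)
  also have "\<dots> = (\<Sum>i\<in>I. \<Sum>l<N. \<Sum>k<N. a i * (A $$ (l, k) * v i $ k * cnj (y $ l)))"
    by (rule sum.swap)
  also have "\<dots> = (\<Sum>i\<in>I. a i * ((A *\<^sub>v v i) \<bullet>c y))"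
  proof (intro sum.cong refl)
    fix i assume "i \<in> I"
    then have "v i \<in> carrier_vec N" using v by auto
    then show "(\<Sum>l<N. \<Sum>k<N. a i * (A $$ (l, k) * v i $ k * cnj (y $ l))) = a i * ((A *\<^sub>v v i) \<bullet>c y)"
      by (simp add: cscalar_prod_sum[OF y] mult_mat_vec_index_sum[OF A] sum_distrib_left
          sum_distrib_right mult_ac del: index_mult_mat_vec)
  qed
  finally show ?thesis .
qed

lemma superposition_cscalar_prod:
  assumes "v ` I \<subseteq> carrier_vec N" "y \<in> carrier_vec N"
  shows "superposition N I v a \<bullet>c y = (\<Sum>i\<in>I. a i * (v i \<bullet>c y))"
proof -
  have "superposition N I v a \<bullet>c y = (1\<^sub>m N *\<^sub>v superposition N I v a) \<bullet>c y" by simp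
  also have "\<dots> = (\<Sum>i\<in>I. a i * ((1\<^sub>m N *\<^sub>v v i) \<bullet>c y))"
    using assms by (intro mult_superposition_cscalar_prod) auto
  also have "\<dots> = (\<Sum>i\<in>I. a i * (v i \<bullet>c y))" using assms(1) by (intro sum.cong) auto
  finally show ?thesis .
qed

lemma cscalar_prod_superposition:
  fixes x :: "complex vec"
  assumes v: "v ` I \<subseteq> carrier_vec N"
  shows "x \<bullet>c superposition N I v a = (\<Sum>i\<in>I. cnj (a i) * (x \<bullet>c v i))"
proof -
  have "x \<bullet>c superposition N I v a = (\<Sum>l<N. \<Sum>i\<in>I. cnj (a i) * (x $ l * cnj (v i $ l)))"
    unfolding cscalar_prod_sum[OF superposition_carrier]
    by (intro sum.cong) (auto simp: superposition_def sum_distrib_left mult_ac)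
  also have "\<dots> = (\<Sum>i\<in>I. \<Sum>l<N. cnj (a i) * (x $ l * cnj (v i $ l)))" by (rule sum.swap)
  also have "\<dots> = (\<Sum>i\<in>I. cnj (a i) * (x \<bullet>c v i))"
    using v by (intro sum.cong refl) (auto simp: cscalar_prod_sum[of _ N] sum_distrib_left image_subset_iff)
  finally show ?thesis .
qed

lemma orthonormal_basisD:
  assumes "orthonormal_basis n I v Q"
  shows "v ` I \<subseteq> carrier_vec (2 ^ n)" "i \<in> I \<Longrightarrow> v i \<in> carrier_vec (2 ^ n)"
    "i \<in> I \<Longrightarrow> j \<in> I \<Longrightarrow> v j \<bullet>c v i = (if i = j then 1 else 0)"
  using assms by (auto simp: orthonormal_basis_def)

text \<open>Orthonormality makes \<open>v\<close> injective, so coefficients attached to indices and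
  coefficients attached to vectors can be translated into each other.\<close>

lemma orthonormal_basis_expansion:
  assumes ob: "orthonormal_basis n I v Q" and I: "finite I"
  shows "Q = range (superposition (2 ^ n) I v)"
proof -
  interpret vec_space "TYPE(complex)" "2 ^ n" .
  note D = orthonormal_basisD[OF ob]
  have inj: "inj_on v I"
  proof (rule inj_onI)
    fix i j assume "i \<in> I" "j \<in> I" "v i = v j"
    then show "i = j" using D(3)[of i j] D(3)[of i i] by (auto split: if_splits)
  qed
  have lc: "lincomb a (v ` I) = superposition (2 ^ n) I v (a \<circ> v)" for a
    using lincomb_dim[of "v ` I" a] I D(1)
    by (intro eq_vecI) (auto simp: superposition_def lincomb_index sum.reindex[OF inj])
  have "Q = span (v ` I)" using ob by (simp add: orthonormal_basis_def)
  also have "\<dots> = range (\<lambda>a. lincomb a (v ` I))"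
    using finite_span[of "v ` I"] I D(1) by auto
  also have "\<dots> = range (superposition (2 ^ n) I v)"
  proof (intro equalityI subsetI)
    fix x assume "x \<in> range (superposition (2 ^ n) I v)"
    then obtain a where "x = superposition (2 ^ n) I v a" by blast
    also have "\<dots> = superposition (2 ^ n) I v ((a \<circ> inv_into I v) \<circ> v)"
      using inj by (auto simp: superposition_def intro!: eq_vecI sum.cong)
    also have "\<dots> = lincomb (a \<circ> inv_into I v) (v ` I)" unfolding lc ..
    finally show "x \<in> range (\<lambda>a. lincomb a (v ` I))" by blast
  qed (auto simp: lc)
  finally show ?thesis .
qed

text \<open>The sum of the rank-one operators |v i><v i|.\<close>

definition basis_projector :: "nat \<Rightarrow> 'i set \<Rightarrow> ('i \<Rightarrow> complex vec) \<Rightarrow> complex mat" where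
  "basis_projector N I v = mat N N (\<lambda>(k, l). \<Sum>i\<in>I. v i $ k * cnj (v i $ l))"

lemma basis_projector_carrier [simp]: "basis_projector N I v \<in> carrier_mat N N"
  by (simp add: basis_projector_def)

lemma basis_projector_mult_vec:
  assumes x: "x \<in> carrier_vec N" and v: "v ` I \<subseteq> carrier_vec N"
  shows "basis_projector N I v *\<^sub>v x = superposition N I v (\<lambda>i. x \<bullet>c v i)"
proof (rule eq_vecI)
  fix k assume "k < dim_vec (superposition N I v (\<lambda>i. x \<bullet>c v i))"
  then have k: "k < N" by (simp add: superposition_def)
  have "(basis_projector N I v *\<^sub>v x) $ k = (\<Sum>l<N. \<Sum>i\<in>I. x $ l * cnj (v i $ l) * v i $ k)"
    unfolding mult_mat_vec_index_sum[OF basis_projector_carrier x k]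
    using k by (intro sum.cong) (auto simp: basis_projector_def sum_distrib_left sum_distrib_right mult_ac)
  also have "\<dots> = (\<Sum>i\<in>I. \<Sum>l<N. x $ l * cnj (v i $ l) * v i $ k)" by (rule sum.swap)
  also have "\<dots> = superposition N I v (\<lambda>i. x \<bullet>c v i) $ k"
    using v k by (auto simp: superposition_def cscalar_prod_sum[of _ N] sum_distrib_right image_subset_iff
        intro!: sum.cong)
  finally show "(basis_projector N I v *\<^sub>v x) $ k = superposition N I v (\<lambda>i. x \<bullet>c v i) $ k" .
qed (simp add: superposition_def basis_projector_def)

lemma mat_eq_if_mult_vec_eq:
  fixes A B :: "complex mat"
  assumes A: "A \<in> carrier_mat N N" and B: "B \<in> carrier_mat N N"
    and eq: "\<And>x. x \<in> carrier_vec N \<Longrightarrow> A *\<^sub>v x = B *\<^sub>v x"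
  shows "A = B"
proof (rule eq_matI)
  fix i j assume "i < dim_row B" "j < dim_col B"
  then have i: "i < N" and j: "j < N" using B by auto
  have "C $$ (i, j) = (C *\<^sub>v unit_vec N j) $ i" if "C \<in> carrier_mat N N" for C :: "complex mat"
    using that i j by (simp add: mult_mat_vec_index_sum[OF that _ i] if_distrib cong: if_cong del: index_mult_mat_vec)
  then show "A $$ (i, j) = B $$ (i, j)" using A B eq[of "unit_vec N j"] by simp
qed (use A B in auto)

text \<open>The matrix maps every vector to a superposition and fixes every superposition, which
  gives both idempotence and the range; self-adjointness is visible on entries.\<close>

lemma is_orthogonal_projector_basis_projector:
  assumes ob: "orthonormal_basis n I v Q" and I: "finite I"
  shows "is_orthogonal_projector n Q (basis_projector (2 ^ n) I v)" (is "is_orthogonal_projector n Q ?P")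
proof -
  note D = orthonormal_basisD[OF ob]
  note P = basis_projector_mult_vec[OF _ D(1)]
  have fix': "?P *\<^sub>v superposition (2 ^ n) I v a = superposition (2 ^ n) I v a" for a
  proof -
    \<comment> \<open>Orthonormality recovers the coefficients of a superposition as scalar products
      with the basis.\<close>
    have "superposition (2 ^ n) I v a \<bullet>c v i = a i" if "i \<in> I" for i
    proof -
      have "superposition (2 ^ n) I v a \<bullet>c v i = (\<Sum>j\<in>I. a j * (if i = j then 1 else 0))"
        using D that by (auto simp: superposition_cscalar_prod intro!: sum.cong)
      then show ?thesis using I that by (simp add: if_distrib cong: if_cong)
    qed
    then show ?thesis unfolding P[OF superposition_carrier] by (auto simp: superposition_def intro!: eq_vecI)
  qed
  have "?P * ?P = ?P"
    by (rule mat_eq_if_mult_vec_eq[OF mult_carrier_mat[OF basis_projector_carrier basis_projector_carrier]])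
      (auto simp: assoc_mult_mat_vec[OF basis_projector_carrier basis_projector_carrier] P fix')
  moreover have "mat_adjoint ?P = ?P"
    by (rule eq_matI) (auto simp: mat_adjoint_index basis_projector_def mult.commute)
  moreover have "{?P *\<^sub>v x | x. x \<in> carrier_vec (2 ^ n)} = Q"
    unfolding orthonormal_basis_expansion[OF assms]
  proof (intro equalityI subsetI)
    fix y assume "y \<in> range (superposition (2 ^ n) I v)"
    then obtain a where "y = superposition (2 ^ n) I v a" by blast
    then have "y = ?P *\<^sub>v superposition (2 ^ n) I v a" using fix' by simp
    moreover have "superposition (2 ^ n) I v a \<in> carrier_vec (2 ^ n)" by simp
    ultimately show "y \<in> {?P *\<^sub>v x | x. x \<in> carrier_vec (2 ^ n)}" by blast
  qed (auto simp: P)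
  ultimately show ?thesis by (simp add: is_orthogonal_projector_def)
qed

lemma mat_adjoint_mult:
  fixes A B :: "complex mat"
  assumes A: "A \<in> carrier_mat N N" and B: "B \<in> carrier_mat N N"
  shows "mat_adjoint (A * B) = mat_adjoint B * mat_adjoint A"
proof (rule eq_matI)
  have A': "mat_adjoint A \<in> carrier_mat N N" and B': "mat_adjoint B \<in> carrier_mat N N"
    using A B by (auto intro!: carrier_matI)
  fix i j assume "i < dim_row (mat_adjoint B * mat_adjoint A)" "j < dim_col (mat_adjoint B * mat_adjoint A)"
  then have i: "i < N" and j: "j < N" using A B by auto
  have "mat_adjoint (A * B) $$ (i, j) = cnj ((A * B) $$ (j, i))"
    using A B i j by (intro mat_adjoint_index) auto
  also have "\<dots> = (mat_adjoint B * mat_adjoint A) $$ (i, j)"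
    unfolding mult_mat_index_sum[OF A B j i] mult_mat_index_sum[OF B' A' i j]
    using A B i j by (auto simp: mat_adjoint_index mult.commute intro!: sum.cong)
  finally show "mat_adjoint (A * B) $$ (i, j) = (mat_adjoint B * mat_adjoint A) $$ (i, j)" .
qed (use A B in auto)

text \<open>A projector fixes its range pointwise, so \<open>R * P = P\<close> and
  \<open>P * R = R\<close>. The adjoint of the first equation is \<open>P * R = P\<close>.\<close>

lemma is_orthogonal_projector_unique:
  assumes P: "is_orthogonal_projector n Q P" and R: "is_orthogonal_projector n Q R"
  shows "P = R"
proof -
  let ?N = "2 ^ n :: nat"
  have absorb: "A * B = B" if A: "is_orthogonal_projector n Q A" and B: "is_orthogonal_projector n Q B" for A B
  proof (rule mat_eq_if_mult_vec_eq[of _ ?N])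
    have c: "A \<in> carrier_mat ?N ?N" "B \<in> carrier_mat ?N ?N"
      using A B by (auto simp: is_orthogonal_projector_def)
    then show "A * B \<in> carrier_mat ?N ?N" "B \<in> carrier_mat ?N ?N" by auto
    fix x :: "complex vec" assume x: "x \<in> carrier_vec ?N"
    have "B *\<^sub>v x \<in> Q" using B x unfolding is_orthogonal_projector_def by blast
    then obtain y where y: "y \<in> carrier_vec ?N" "B *\<^sub>v x = A *\<^sub>v y"
      using A unfolding is_orthogonal_projector_def by blast
    have "(A * B) *\<^sub>v x = A *\<^sub>v (A *\<^sub>v y)" using c x y by simp
    also have "\<dots> = (A * A) *\<^sub>v y" using c y by simp
    also have "\<dots> = B *\<^sub>v x" using A y by (simp add: is_orthogonal_projector_def)
    finally show "(A * B) *\<^sub>v x = B *\<^sub>v x" .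
  qed
  have "P = mat_adjoint (R * P)" using P absorb[OF R P] by (simp add: is_orthogonal_projector_def)
  also have "\<dots> = P * R"
    using P R by (subst mat_adjoint_mult[of _ ?N]) (auto simp: is_orthogonal_projector_def)
  also have "\<dots> = R" by (rule absorb[OF P R])
  finally show ?thesis .
qed

text \<open>Resolves the definite description, so that traces can be computed in the basis of word
  states.\<close>

lemma orthogonal_projector_eq_basis_projector:
  assumes "orthonormal_basis n I v Q" "finite I"
  shows "orthogonal_projector n Q = basis_projector (2 ^ n) I v"
  unfolding orthogonal_projector_def
  using is_orthogonal_projector_basis_projector[OF assms] is_orthogonal_projector_unique
  by (intro the_equality)

text \<open>Since Tr(A |v><v|) = <v|A|v>, the trace is the sum of these expectations.\<close>

lemma mat_trace_mult_basis_projector: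
  fixes A :: "complex mat"
  assumes A: "A \<in> carrier_mat N N" and v: "v ` I \<subseteq> carrier_vec N"
  shows "mat_trace (A * basis_projector N I v) = (\<Sum>i\<in>I. (A *\<^sub>v v i) \<bullet>c v i)"
proof -
  have "mat_trace (A * basis_projector N I v) = (\<Sum>k<N. \<Sum>l<N. A $$ (k, l) * basis_projector N I v $$ (l, k))"
    unfolding mat_trace_def using A
    by (intro sum.cong) (auto simp: mult_mat_index_sum[OF A basis_projector_carrier] simp del: index_mult_mat(1))
  also have "\<dots> = (\<Sum>k<N. \<Sum>l<N. \<Sum>i\<in>I. A $$ (k, l) * v i $ l * cnj (v i $ k))"
    by (intro sum.cong) (auto simp: basis_projector_def sum_distrib_left mult_ac)
  also have "\<dots> = (\<Sum>k<N. \<Sum>i\<in>I. \<Sum>l<N. A $$ (k, l) * v i $ l * cnj (v i $ k))"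
    by (intro sum.cong refl sum.swap)
  also have "\<dots> = (\<Sum>i\<in>I. \<Sum>k<N. \<Sum>l<N. A $$ (k, l) * v i $ l * cnj (v i $ k))"
    by (rule sum.swap)
  also have "\<dots> = (\<Sum>i\<in>I. (A *\<^sub>v v i) \<bullet>c v i)"
  proof (intro sum.cong refl)
    fix i assume "i \<in> I"
    then have i: "v i \<in> carrier_vec N" using v by auto
    show "(\<Sum>k<N. \<Sum>l<N. A $$ (k, l) * v i $ l * cnj (v i $ k)) = (A *\<^sub>v v i) \<bullet>c v i"
      by (simp add: cscalar_prod_sum[OF i] mult_mat_vec_index_sum[OF A i] sum_distrib_right del: index_mult_mat_vec)
  qed
  finally show ?thesis .
qed

text \<open>The basis witnessing detectability may differ from the word states. This basis-free
  consequence can be evaluated at any vector of the code.\<close>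

lemma detectable_imp_scalar:
  assumes det: "detectable n Q \<alpha>" and a: "\<alpha> \<in> carrier_mat (2 ^ n) (2 ^ n)"
  shows "\<exists>c. \<forall>x\<in>Q. (\<alpha> *\<^sub>v x) \<bullet>c x = c * (x \<bullet>c x)"
proof -
  let ?N = "2 ^ n :: nat"
  obtain m v where ob: "orthonormal_basis n {..<m::nat} v Q"
    and diag: "\<And>i j. i < m \<Longrightarrow> j < m \<Longrightarrow> sandwich (v i) \<alpha> (v i) = sandwich (v j) \<alpha> (v j)"
    and off: "\<And>i j. i < m \<Longrightarrow> j < m \<Longrightarrow> i \<noteq> j \<Longrightarrow> sandwich (v i) \<alpha> (v j) = 0"
    using det unfolding detectable_def by blast
  note D = orthonormal_basisD[OF ob]
  \<comment> \<open>Any diagonal entry would serve as reference; for \<open>m = 0\<close> the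
    statement \<open>entry\<close> is vacuous.\<close>
  let ?c = "sandwich (v 0) \<alpha> (v 0)"
  have entry: "(\<alpha> *\<^sub>v v j) \<bullet>c v i = ?c * (v j \<bullet>c v i)" if "i < m" "j < m" for i j
    using that diag[of i 0] off[of i j] D(3)[of i j] by (auto simp: sandwich_def)
  have "(\<alpha> *\<^sub>v x) \<bullet>c x = ?c * (x \<bullet>c x)" if "x \<in> Q" for x
  proof -
    obtain a where x: "x = superposition ?N {..<m} v a"
      using \<open>x \<in> Q\<close> orthonormal_basis_expansion[OF ob] by blast
    have "(\<alpha> *\<^sub>v x) \<bullet>c x = (\<Sum>i<m. a i * ((\<alpha> *\<^sub>v v i) \<bullet>c x))"
      unfolding x by (rule mult_superposition_cscalar_prod[OF a D(1) superposition_carrier])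
    also have "\<dots> = (\<Sum>i<m. a i * (\<Sum>j<m. cnj (a j) * ((\<alpha> *\<^sub>v v i) \<bullet>c v j)))"
      unfolding x cscalar_prod_superposition[OF D(1)] ..
    also have "\<dots> = ?c * (\<Sum>i<m. a i * (\<Sum>j<m. cnj (a j) * (v i \<bullet>c v j)))"
      by (simp add: entry sum_distrib_left mult_ac)
    also have "(\<Sum>i<m. a i * (\<Sum>j<m. cnj (a j) * (v i \<bullet>c v j))) = (\<Sum>i<m. a i * (v i \<bullet>c x))"
      unfolding x cscalar_prod_superposition[OF D(1)] ..
    also have "\<dots> = x \<bullet>c x"
      unfolding x by (rule superposition_cscalar_prod[OF D(1) superposition_carrier, symmetric])
    finally show ?thesis .
  qed
  then show ?thesis by blast
qed

section \<open>The weight enumerator\<close>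

text \<open>Each word commutes or anticommutes with \<open>\<beta>\<close>, and never both, so the
  two counts come from a partition of \<open>W\<close>.\<close>

lemma anticommuting_eq_not_commuting:
  assumes W: "W \<subseteq> pauli_ops n" and b: "\<beta> \<in> pauli_ops n"
  shows "{\<omega> \<in> W. \<omega> * \<beta> = - (\<beta> * \<omega>)} = W - {\<omega> \<in> W. \<omega> * \<beta> = \<beta> * \<omega>}"
proof -
  have "\<omega> * \<beta> = - (\<beta> * \<omega>) \<longleftrightarrow> \<omega> * \<beta> \<noteq> \<beta> * \<omega>" if "\<omega> \<in> W" for \<omega>
  proof -
    have w: "\<omega> \<in> pauli_ops n" using that W by auto
    obtain c where "c \<in> {1, - 1}" "\<omega> * \<beta> = c \<cdot>\<^sub>m (\<beta> * \<omega>)" using pauli_ops_commute[OF w b] by blast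
    then have "\<omega> * \<beta> = \<beta> * \<omega> \<or> \<omega> * \<beta> = - (\<beta> * \<omega>)" by (auto simp: minus_one_smult_mat)
    then show ?thesis using pauli_ops_neq_uminus[OF pauli_ops_mult[OF b w]] by auto
  qed
  then show ?thesis by blast
qed

text \<open>Because the two alternatives exclude each other, the sign from
  \<open>pauli_ops_commute\<close> can be read off from the commutation test.\<close>

lemma word_expectation:
  assumes w: "\<omega> \<in> pauli_ops n" and b: "\<beta> \<in> pauli_ops n" and x: "x \<in> carrier_vec (2 ^ n)"
  shows "(\<beta> *\<^sub>v (\<omega> *\<^sub>v x)) \<bullet>c (\<omega> *\<^sub>v x) =
    (if \<omega> * \<beta> = \<beta> * \<omega> then 1 else - 1) * ((\<beta> *\<^sub>v x) \<bullet>c x)"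
proof -
  obtain c where c: "c \<in> {1, - 1}" "\<omega> * \<beta> = c \<cdot>\<^sub>m (\<beta> * \<omega>)" using pauli_ops_commute[OF w b] by blast
  have "c = (if \<omega> * \<beta> = \<beta> * \<omega> then 1 else - 1)"
    using c pauli_ops_neq_uminus[OF pauli_ops_mult[OF b w]] by (auto simp: minus_one_smult_mat)
  then show ?thesis using pauli_ops_conjugate_expectation[OF w pauli_ops_carrier[OF b] x c] by simp
qed

lemma sum_word_expectation:
  assumes W: "W \<subseteq> pauli_ops n" and b: "\<beta> \<in> pauli_ops n" and x: "x \<in> carrier_vec (2 ^ n)"
  shows "(\<Sum>\<omega>\<in>W. (\<beta> *\<^sub>v (\<omega> *\<^sub>v x)) \<bullet>c (\<omega> *\<^sub>v x)) =
    (of_nat (commuting_words W \<beta>) - of_nat (anticommuting_words W \<beta>)) * ((\<beta> *\<^sub>v x) \<bullet>c x)"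
proof -
  let ?C = "{\<omega> \<in> W. \<omega> * \<beta> = \<beta> * \<omega>}"
  have fin: "finite W" using W finite_pauli_ops finite_subset by blast
  have "(\<Sum>\<omega>\<in>W. (\<beta> *\<^sub>v (\<omega> *\<^sub>v x)) \<bullet>c (\<omega> *\<^sub>v x)) =
        (\<Sum>\<omega>\<in>W. (if \<omega> * \<beta> = \<beta> * \<omega> then 1 else - 1)) * ((\<beta> *\<^sub>v x) \<bullet>c x)"
    unfolding sum_distrib_right using W b x by (intro sum.cong refl word_expectation) auto
  also have "(\<Sum>\<omega>\<in>W. (if \<omega> * \<beta> = \<beta> * \<omega> then 1 else - 1 :: complex)) =
             (\<Sum>\<omega>\<in>W - ?C. - 1) + (\<Sum>\<omega>\<in>?C. 1)"
    using fin by (subst sum.subset_diff[of ?C]) (auto intro!: arg_cong2[of _ _ _ _ "(+)"] sum.cong)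
  finally show ?thesis
    by (simp add: commuting_words_def anticommuting_words_def anticommuting_eq_not_commuting[OF W b])
qed

theorem theorem31:
  fixes n M d :: nat
    and S W :: "complex mat set"
    and Q :: "complex vec set"
  assumes "cws_code n M d S W Q"
  shows "(\<forall>j\<in>{0..n}. shor_laflamme_A n Q j =
            1 / (of_nat M)^2 *
              (\<Sum>\<beta>\<in>error_ops_weight n j \<inter> forget_phase n ` S.
                 of_real (\<bar>real (commuting_words W \<beta>) - real (anticommuting_words W \<beta>)\<bar>^2)))
       \<and> (\<forall>j. j < d \<longrightarrow> shor_laflamme_A n Q j =
            of_nat (card {\<beta> \<in> error_ops_weight n j \<inter> forget_phase n ` S.
                            commuting_words W \<beta> = M}))"
proof -
  let ?N = "2 ^ n :: nat"
  have S: "cws_group n S" and W: "W \<subseteq> pauli_ops n" and M: "card W = M" and one: "1\<^sub>m ?N \<in> W"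
    and dist: "minimum_distance n Q d"
    using assms by (auto simp: cws_code_def)
  obtain \<psi> where \<psi>: "stabilizer_state n S \<psi>" and ob: "orthonormal_basis n W (\<lambda>\<omega>. \<omega> *\<^sub>v \<psi>) Q"
    using assms by (auto simp: cws_code_def)
  have st: "stabilizer_group n S" using S by (simp add: cws_group_def)
  have p: "\<psi> \<in> carrier_vec ?N" using \<psi> by (simp add: stabilizer_state_def)
  have fin: "finite W" using W finite_pauli_ops finite_subset by blast
  \<comment> \<open>The identity is a word, so \<open>M\<close> is positive and its square can be
    cancelled in the second claim.\<close>
  have Mpos: "M > 0" using M fin one by (auto simp: card_gt_0_iff)
  let ?P = "orthogonal_projector n Q"
  let ?e = "\<lambda>\<beta>. (\<beta> *\<^sub>v \<psi>) \<bullet>c \<psi>"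
  let ?D = "\<lambda>\<beta>. real (commuting_words W \<beta>) - real (anticommuting_words W \<beta>)"
  note D = orthonormal_basisD[OF ob]
  have P: "?P = basis_projector ?N W (\<lambda>\<omega>. \<omega> *\<^sub>v \<psi>)"
    by (rule orthogonal_projector_eq_basis_projector[OF ob fin])
  have weight: "error_ops_weight n j \<subseteq> error_ops n" for j by (auto simp: error_ops_weight_def)
  have tr: "mat_trace (\<beta> * ?P) = of_real (?D \<beta>) * ?e \<beta>" if "\<beta> \<in> error_ops n" for \<beta>
    unfolding P mat_trace_mult_basis_projector[OF error_ops_carrier[OF that] D(1)]
    using sum_word_expectation[OF W _ p] that error_ops_subset_pauli_ops by auto
  have trP: "mat_trace ?P = of_nat M"
  proof -
    have "mat_trace ?P = mat_trace (1\<^sub>m ?N * ?P)"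
      unfolding P left_mult_one_mat[OF basis_projector_carrier] ..
    also have "\<dots> = (\<Sum>\<omega>\<in>W. (1\<^sub>m ?N *\<^sub>v (\<omega> *\<^sub>v \<psi>)) \<bullet>c (\<omega> *\<^sub>v \<psi>))"
      unfolding P by (intro mat_trace_mult_basis_projector D(1)) simp
    also have "\<dots> = (\<Sum>\<omega>\<in>W. 1)" using D(2,3) by (intro sum.cong refl) simp
    finally show ?thesis using M by simp
  qed
  \<comment> \<open>Proved for every \<open>j\<close>, since the second claim bounds
    \<open>j\<close> by \<open>d\<close> and not by \<open>n\<close>.\<close>
  have A: "shor_laflamme_A n Q j = 1 / (of_nat M)\<^sup>2 *
      (\<Sum>\<beta>\<in>error_ops_weight n j \<inter> forget_phase n ` S. of_real (\<bar>?D \<beta>\<bar>\<^sup>2))" for j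
  proof -
    have "(\<Sum>\<beta>\<in>error_ops_weight n j. mat_trace (\<beta> * ?P) * mat_trace (\<beta> * ?P)) =
          (\<Sum>\<beta>\<in>error_ops_weight n j. if \<beta> \<in> forget_phase n ` S then of_real (\<bar>?D \<beta>\<bar>\<^sup>2) else 0)"
    proof (intro sum.cong refl)
      fix \<beta> assume "\<beta> \<in> error_ops_weight n j"
      then have b: "\<beta> \<in> error_ops n" using weight by auto
      \<comment> \<open>The squared expectation is 1 on the phase-free image of \<open>S\<close> and
        0 elsewhere, so it acts as an indicator.\<close>
      have "mat_trace (\<beta> * ?P) * mat_trace (\<beta> * ?P) = of_real (\<bar>?D \<beta>\<bar>\<^sup>2) * (?e \<beta>)\<^sup>2"
        unfolding tr[OF b] by (simp add: power2_eq_square)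
      then show "mat_trace (\<beta> * ?P) * mat_trace (\<beta> * ?P) =
          (if \<beta> \<in> forget_phase n ` S then of_real (\<bar>?D \<beta>\<bar>\<^sup>2) else 0)"
        using stabilizer_expectation_square[OF st \<psi>, of \<beta>]
          stabilizer_expectation_eq_0[OF S \<psi> b] by auto
    qed
    also have "\<dots> = (\<Sum>\<beta>\<in>error_ops_weight n j \<inter> forget_phase n ` S. of_real (\<bar>?D \<beta>\<bar>\<^sup>2))"
      by (rule sum.inter_restrict[symmetric]) (rule finite_subset[OF weight finite_error_ops])
    finally show ?thesis by (simp add: shor_laflamme_A_def Let_def trP)
  qed
  moreover have "shor_laflamme_A n Q j =
      of_nat (card {\<beta> \<in> error_ops_weight n j \<inter> forget_phase n ` S. commuting_words W \<beta> = M})"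
    if j: "j < d" for j
  proof -
    let ?B = "error_ops_weight n j \<inter> forget_phase n ` S"
    have words: "commuting_words W \<beta> = M \<and> anticommuting_words W \<beta> = 0" if "\<beta> \<in> ?B" for \<beta>
    proof -
      have b: "\<beta> \<in> error_ops n" "pauli_weight n \<beta> = j" "\<beta> \<in> forget_phase n ` S"
        using that by (auto simp: error_ops_weight_def)
      have bP: "\<beta> \<in> pauli_ops n" using b(1) error_ops_subset_pauli_ops by auto
      have "detectable n Q \<beta>" using dist b j by (simp add: minimum_distance_def)
      then obtain c where c: "\<And>x. x \<in> Q \<Longrightarrow> (\<beta> *\<^sub>v x) \<bullet>c x = c * (x \<bullet>c x)"
        using detectable_imp_scalar error_ops_carrier[OF b(1)] by blast
      \<comment> \<open>A word state is the superposition with a single coefficient 1; membership in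
        \<open>Q\<close> allows \<open>c\<close> to be evaluated there.\<close>
      have "\<omega> *\<^sub>v \<psi> \<in> Q" if "\<omega> \<in> W" for \<omega>
      proof -
        have "\<omega> *\<^sub>v \<psi> = superposition ?N W (\<lambda>\<omega>. \<omega> *\<^sub>v \<psi>) (\<lambda>\<omega>'. if \<omega>' = \<omega> then 1 else 0)"
          using that fin pauli_ops_carrier W
          by (intro eq_vecI) (auto simp: superposition_def if_distrib[of "\<lambda>a. a * _"] cong: if_cong)
        then show ?thesis using orthonormal_basis_expansion[OF ob fin] by auto
      qed
      then have const: "(\<beta> *\<^sub>v (\<omega> *\<^sub>v \<psi>)) \<bullet>c (\<omega> *\<^sub>v \<psi>) = c" if "\<omega> \<in> W" for \<omega>
        using c that D(3) by simp
      \<comment> \<open>The identity word ties the common value \<open>c\<close> to the expectation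
        in \<open>\<psi>\<close>, which is nonzero; a word anticommuting with \<open>\<beta>\<close>
        would give \<open>- c\<close> instead.\<close>
      have "?e \<beta> = c" using const[OF one] p by simp
      moreover have "?e \<beta> \<noteq> 0" using stabilizer_expectation_square[OF st \<psi> b(3)] by auto
      ultimately have "\<omega> * \<beta> = \<beta> * \<omega>" if "\<omega> \<in> W" for \<omega>
        using const[OF that] word_expectation[of \<omega> n \<beta> \<psi>] that W bP p by (auto split: if_splits)
      then have "{\<omega> \<in> W. \<omega> * \<beta> = \<beta> * \<omega>} = W" by auto
      then show ?thesis
        unfolding commuting_words_def anticommuting_words_def anticommuting_eq_not_commuting[OF W bP]
        by (simp only: M) simp
    qed
    have "shor_laflamme_A n Q j = 1 / (of_nat M)\<^sup>2 * (\<Sum>\<beta>\<in>?B. (of_nat M)\<^sup>2)"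
      unfolding A using words by (intro arg_cong[of _ _ "(*) _"] sum.cong) auto
    also have "\<dots> = of_nat (card ?B)" using Mpos by simp
    \<comment> \<open>By \<open>words\<close> the condition holds throughout \<open>?B\<close>, so
      imposing it removes nothing.\<close>
    also have "?B = {\<beta> \<in> ?B. commuting_words W \<beta> = M}" using words by auto
    finally show ?thesis .
  qed
  ultimately show ?thesis by blast
qed

end
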